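(* There is an algorithm which, given a positive semidefinite matrix $L\in\mathbb{R}^{m\times m}$ and a description (cost vectors $c_1,\dots,c_p\in\mathbb{Z}^m$ and sets $K_1,\dots,K_p\subseteq\mathbb{Z}$) of a linear family $$\mathcal{C}=\{S\subseteq[m]:\ c_1(S)\in K_1,\ c_2(S)\in K_2,\ \dots,\ c_p(S)\in K_p\},$$ samples a set $S\in\mathcal{C}$ with probability proportional to $\det(L_{S,S})$, i.e. with probability $\det(L_{S,S})/\sum_{T\in\mathcal{C}}\det(L_{T,T})$. The running time of the algorithm is polynomial in $m$ and $\prod_{j=1}^p(\|c_j\|_1+1)$.
   Context: $[m]=\{1,\dots,m\}$; for $c\in\mathbb{Z}^m$, $c(S)=\sum_{i\in S}c_i$ and $\|c\|_1=\sum_i|c_i|$. $L_{S,S}$ is the principal submatrix of $L$ with rows and columns in $S$, and $\det(L_{\emptyset,\emptyset})=1$. The sets $K_j$ are given so that membership of an integer in $K_j$ can be tested at unit cost. Running time (not counting the time to read the input) counts exact real arithmetic operations, and tosses of a coin with a computed bias in $[0,1]$, at unit cost. The sampling problem is considered only for inputs for which the normalizing sum is positive. *)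

theory Defs
  imports
    "HOL-Probability.Probability"
    "HOL-Computational_Algebra.Polynomial"
    "Jordan_Normal_Form.DL_Submatrix"
    "Jordan_Normal_Form.Determinant"
begin

text \<open>
  A randomized real random access machine, given as a small imperative language.  The memory
  consists of integer and real variables and of integer and real arrays with two integer indices.
  Reals are exact.  To keep the unit-cost measure honest there is no rounding of reals to integers,
  integers (which serve as indices) can only be added, subtracted and compared, and the only
  constants in programs are integers.  The sets \<open>K\<^sub>j\<close> are accessible only through the
  test \<open>InK\<close>.
\<close>

datatype iexp =
    IConst int
  | IVar string
  | IArr string iexp iexp
  | IAdd iexp iexp
  | ISub iexp iexp

datatype rexp =
    RVar string
  | RArr string iexp iexp
  | ROfInt iexp
  | RAdd rexp rexp
  | RSub rexp rexp
  | RMul rexp rexp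
  | RDiv rexp rexp

datatype bexp =
    ILess iexp iexp
  | RLess rexp rexp
  | InK iexp iexp
  | BNot bexp
  | BAnd bexp bexp

datatype com =
    Skip
  | ISet string iexp
  | IPut string iexp iexp iexp
  | RSet string rexp
  | RPut string iexp iexp rexp
  | Toss string rexp
  | Seq com com
  | Cond bexp com com
  | While bexp com

record state =
  ivar :: "string \<Rightarrow> int"
  iarr :: "string \<Rightarrow> int \<Rightarrow> int \<Rightarrow> int"
  rvar :: "string \<Rightarrow> real"
  rarr :: "string \<Rightarrow> int \<Rightarrow> int \<Rightarrow> real"

primrec ival :: "iexp \<Rightarrow> state \<Rightarrow> int" where
  "ival (IConst k) \<sigma> = k"
| "ival (IVar x) \<sigma> = ivar \<sigma> x"
| "ival (IArr a e1 e2) \<sigma> = iarr \<sigma> a (ival e1 \<sigma>) (ival e2 \<sigma>)"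
| "ival (IAdd e1 e2) \<sigma> = ival e1 \<sigma> + ival e2 \<sigma>"
| "ival (ISub e1 e2) \<sigma> = ival e1 \<sigma> - ival e2 \<sigma>"

text \<open>
  Division by zero yields zero, as usual in HOL; a program can test the divisor beforehand.
\<close>

primrec rval :: "rexp \<Rightarrow> state \<Rightarrow> real" where
  "rval (RVar x) \<sigma> = rvar \<sigma> x"
| "rval (RArr a e1 e2) \<sigma> = rarr \<sigma> a (ival e1 \<sigma>) (ival e2 \<sigma>)"
| "rval (ROfInt e) \<sigma> = real_of_int (ival e \<sigma>)"
| "rval (RAdd e1 e2) \<sigma> = rval e1 \<sigma> + rval e2 \<sigma>"
| "rval (RSub e1 e2) \<sigma> = rval e1 \<sigma> - rval e2 \<sigma>"
| "rval (RMul e1 e2) \<sigma> = rval e1 \<sigma> * rval e2 \<sigma>"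
| "rval (RDiv e1 e2) \<sigma> = rval e1 \<sigma> / rval e2 \<sigma>"

text \<open>In the following, \<open>orc j x\<close> is the answer to the membership test \<open>x \<in> K\<^sub>j\<close>.\<close>

primrec bval :: "(int \<Rightarrow> int \<Rightarrow> bool) \<Rightarrow> bexp \<Rightarrow> state \<Rightarrow> bool" where
  "bval orc (ILess e1 e2) \<sigma> = (ival e1 \<sigma> < ival e2 \<sigma>)"
| "bval orc (RLess e1 e2) \<sigma> = (rval e1 \<sigma> < rval e2 \<sigma>)"
| "bval orc (InK e1 e2) \<sigma> = orc (ival e1 \<sigma>) (ival e2 \<sigma>)"
| "bval orc (BNot b) \<sigma> = (\<not> bval orc b \<sigma>)"
| "bval orc (BAnd b1 b2) \<sigma> = (bval orc b1 \<sigma> \<and> bval orc b2 \<sigma>)"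

text \<open>
  The cost of evaluating an expression is the number of its nodes: every arithmetic operation,
  comparison, membership test, memory access and constant counts 1.
\<close>

primrec icost :: "iexp \<Rightarrow> nat" where
  "icost (IConst k) = 1"
| "icost (IVar x) = 1"
| "icost (IArr a e1 e2) = icost e1 + icost e2 + 1"
| "icost (IAdd e1 e2) = icost e1 + icost e2 + 1"
| "icost (ISub e1 e2) = icost e1 + icost e2 + 1"

primrec rcost :: "rexp \<Rightarrow> nat" where
  "rcost (RVar x) = 1"
| "rcost (RArr a e1 e2) = icost e1 + icost e2 + 1"
| "rcost (ROfInt e) = icost e + 1"
| "rcost (RAdd e1 e2) = rcost e1 + rcost e2 + 1"
| "rcost (RSub e1 e2) = rcost e1 + rcost e2 + 1"
| "rcost (RMul e1 e2) = rcost e1 + rcost e2 + 1"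
| "rcost (RDiv e1 e2) = rcost e1 + rcost e2 + 1"

primrec bcost :: "bexp \<Rightarrow> nat" where
  "bcost (ILess e1 e2) = icost e1 + icost e2 + 1"
| "bcost (RLess e1 e2) = rcost e1 + rcost e2 + 1"
| "bcost (InK e1 e2) = icost e1 + icost e2 + 1"
| "bcost (BNot b) = bcost b + 1"
| "bcost (BAnd b1 b2) = bcost b1 + bcost b2 + 1"

text \<open>
  A result is \<open>Some (\<sigma>, t)\<close> for a run that ends in state \<open>\<sigma>\<close> after time \<open>t\<close>, and \<open>None\<close> for a run
  that fails or has not ended.
\<close>

type_synonym result = "(state \<times> nat) option"

definition tick :: "nat \<Rightarrow> result pmf \<Rightarrow> result pmf" where
  "tick s D = map_pmf (map_option (\<lambda>(\<sigma>, t). (\<sigma>, s + t))) D"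

definition and_then :: "result pmf \<Rightarrow> (state \<Rightarrow> result pmf) \<Rightarrow> result pmf" where
  "and_then D f =
     bind_pmf D (\<lambda>r. case r of None \<Rightarrow> return_pmf None | Some (\<sigma>, t) \<Rightarrow> tick t (f \<sigma>))"

text \<open>
  \<open>exec orc n c \<sigma>\<close> is the distribution of the result of running \<open>c\<close> from \<open>\<sigma>\<close>.  The number \<open>n\<close> is not
  visible to the program; it bounds the unrolling of loops, and a run that exceeds it counts as not
  ended.  Tossing a coin whose bias is outside \<open>[0,1]\<close> is a failure.
\<close>

fun exec :: "(int \<Rightarrow> int \<Rightarrow> bool) \<Rightarrow> nat \<Rightarrow> com \<Rightarrow> state \<Rightarrow> result pmf" where
  "exec orc n Skip \<sigma> = return_pmf (Some (\<sigma>, 1))"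
| "exec orc n (ISet x e) \<sigma> =
     return_pmf (Some (\<sigma>\<lparr>ivar := (ivar \<sigma>)(x := ival e \<sigma>)\<rparr>, icost e + 1))"
| "exec orc n (IPut a e1 e2 e) \<sigma> =
     return_pmf (Some
       (\<sigma>\<lparr>iarr := (iarr \<sigma>)(a := (iarr \<sigma> a)(ival e1 \<sigma> :=
            (iarr \<sigma> a (ival e1 \<sigma>))(ival e2 \<sigma> := ival e \<sigma>)))\<rparr>,
        icost e1 + icost e2 + icost e + 1))"
| "exec orc n (RSet x e) \<sigma> =
     return_pmf (Some (\<sigma>\<lparr>rvar := (rvar \<sigma>)(x := rval e \<sigma>)\<rparr>, rcost e + 1))"
| "exec orc n (RPut a e1 e2 e) \<sigma> =
     return_pmf (Some
       (\<sigma>\<lparr>rarr := (rarr \<sigma>)(a := (rarr \<sigma> a)(ival e1 \<sigma> :=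
            (rarr \<sigma> a (ival e1 \<sigma>))(ival e2 \<sigma> := rval e \<sigma>)))\<rparr>,
        icost e1 + icost e2 + rcost e + 1))"
| "exec orc n (Toss x e) \<sigma> =
     (if 0 \<le> rval e \<sigma> \<and> rval e \<sigma> \<le> 1
      then map_pmf (\<lambda>h. Some (\<sigma>\<lparr>ivar := (ivar \<sigma>)(x := (if h then 1 else 0))\<rparr>, rcost e + 1))
             (bernoulli_pmf (rval e \<sigma>))
      else return_pmf None)"
| "exec orc n (Seq c1 c2) \<sigma> = and_then (exec orc n c1 \<sigma>) (\<lambda>\<sigma>'. exec orc n c2 \<sigma>')"
| "exec orc n (Cond b c1 c2) \<sigma> =
     tick (bcost b) (if bval orc b \<sigma> then exec orc n c1 \<sigma> else exec orc n c2 \<sigma>)"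
| "exec orc 0 (While b c) \<sigma> = return_pmf None"
| "exec orc (Suc n) (While b c) \<sigma> =
     tick (bcost b)
       (if bval orc b \<sigma>
        then and_then (exec orc n c \<sigma>) (\<lambda>\<sigma>'. exec orc n (While b c) \<sigma>')
        else return_pmf (Some (\<sigma>, 0)))"

definition psd_mat :: "nat \<Rightarrow> real mat \<Rightarrow> bool" where
  "psd_mat m L \<longleftrightarrow> L \<in> carrier_mat m m \<and> transpose_mat L = L \<and>
     (\<forall>v \<in> carrier_vec m. 0 \<le> v \<bullet> (L *\<^sub>v v))"

text \<open>
  The ground set is \<open>{..<m}\<close> rather than \<open>{1..m}\<close>, following the indexing of matrices; likewise the
  constraints are numbered from 0.  Only the values \<open>c j i\<close> with \<open>j < p\<close>, \<open>i < m\<close> and \<open>K j\<close> with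
  \<open>j < p\<close> are relevant.
\<close>

definition linear_family ::
    "nat \<Rightarrow> nat \<Rightarrow> (nat \<Rightarrow> nat \<Rightarrow> int) \<Rightarrow> (nat \<Rightarrow> int set) \<Rightarrow> nat set set" where
  "linear_family m p c K = {S. S \<subseteq> {..<m} \<and> (\<forall>j<p. (\<Sum>i\<in>S. c j i) \<in> K j)}"

definition l1_norm :: "nat \<Rightarrow> (nat \<Rightarrow> int) \<Rightarrow> nat" where
  "l1_norm m v = (\<Sum>i<m. nat \<bar>v i\<bar>)"

definition principal_minor :: "real mat \<Rightarrow> nat set \<Rightarrow> real" where
  "principal_minor L S = det (submatrix L S S)"

definition membership :: "nat \<Rightarrow> (nat \<Rightarrow> int set) \<Rightarrow> int \<Rightarrow> int \<Rightarrow> bool" where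
  "membership p K j x \<longleftrightarrow> 0 \<le> j \<and> j < int p \<and> x \<in> K (nat j)"

text \<open>The input is in memory at the start; all other memory cells are zero.\<close>

definition init_state :: "nat \<Rightarrow> real mat \<Rightarrow> nat \<Rightarrow> (nat \<Rightarrow> nat \<Rightarrow> int) \<Rightarrow> state" where
  "init_state m L p c =
     \<lparr>ivar = (\<lambda>_. 0)(''m'' := int m, ''p'' := int p),
      iarr = (\<lambda>_ _ _. 0)(''c'' := (\<lambda>j i. if 0 \<le> j \<and> j < int p \<and> 0 \<le> i \<and> i < int m
                                        then c (nat j) (nat i) else 0)),
      rvar = (\<lambda>_. 0),
      rarr = (\<lambda>_ _ _. 0)(''L'' := (\<lambda>i j. if 0 \<le> i \<and> i < int m \<and> 0 \<le> j \<and> j < int m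
                                        then L $$ (nat i, nat j) else 0))\<rparr>"

text \<open>The output is read from the array \<open>S\<close>, which holds the characteristic vector of a set.\<close>

definition output_set :: "nat \<Rightarrow> state \<Rightarrow> nat set" where
  "output_set m \<sigma> = {i. i < m \<and> iarr \<sigma> ''S'' 0 (int i) = 1}"

definition outcome :: "nat \<Rightarrow> result \<Rightarrow> nat set option" where
  "outcome m = map_option (\<lambda>(\<sigma>, t). output_set m \<sigma>)"

text \<open>
  The size of the input: \<open>m\<close> and \<open>p\<close>, the entries of \<open>L\<close> and of the cost vectors, and the \<open>p\<close> sets.
  Reading the input takes time linear in this number.  It is not bounded in terms of \<open>m\<close> and
  \<open>\<Prod>\<^sub>j (\<parallel>c\<^sub>j\<parallel>\<^sub>1 + 1)\<close>, since any number of the cost vectors may be zero.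
\<close>

definition input_size :: "nat \<Rightarrow> nat \<Rightarrow> nat" where
  "input_size m p = 2 + m * m + p * m + p"

text \<open>Bivariate polynomials are polynomials with polynomial coefficients.\<close>

definition poly2 :: "nat poly poly \<Rightarrow> nat \<Rightarrow> nat \<Rightarrow> nat" where
  "poly2 Q x y = poly (poly Q [:y:]) x"

end

theory Submission
  imports Defs
begin

text \<open>
  For diagonal \<open>D\<close>, \<open>det (L + D) = (\<Sum>S. det L\<^bsub>S,S\<^esub> * (\<Prod>i\<notin>S. D\<^sub>i))\<close>.  By Lagrange interpolation at positive
  nodes, the indicator of \<open>c\<^sub>j(S) \<in> K\<^sub>j\<close> is a combination of \<open>\<parallel>c\<^sub>j\<parallel>\<^sub>1 + 1\<close> functions \<open>(\<Prod>i\<notin>S. y powi c\<^sub>j(i))\<close>, so the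
  indicator of the family is a combination of \<open>\<Prod>\<^sub>j (\<parallel>c\<^sub>j\<parallel>\<^sub>1 + 1)\<close> multiplicative functions, and the
  normalizing sum is the same combination of determinants \<open>det (L + D)\<close>.  Requiring or forbidding
  some elements only removes diagonal entries of \<open>D\<close>, or rows and columns of \<open>L\<close>, so the
  conditional probabilities are computed in the same way and the elements are decided one by one.
  All matrices are positive semidefinite, hence Gaussian elimination needs no pivoting, not even in
  the singular case: a zero pivot has a zero row, and \<open>x / 0 = 0\<close>.
\<close>

section \<open>Determinants over finite index sets\<close>

text \<open>The normalizing sum adds up those coefficients of a generating function whose exponents
  the sets \<open>K j\<close> admit, and the values of that function are determinants. The weights
  depend on the costs and the sets only, not on \<open>L\<close> and not on the elements decided so
  far, so one grid serves all conditional probabilities. Scaling \<open>L\<close> by the factors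
  would lose symmetry or call for their square roots, which the machine lacks. Adding a diagonal
  avoids both; the price is that factors belong to the elements outside the set. The machine shapes
  the rest. Indices cannot be multiplied, so the product grid is a sequence of appended blocks found
  by a running counter. Loops carry an unrolling bound, so every claim about a program has the form
  "for all large bounds"; thresholds of parts combine by maximum, and since a toss has two outcomes,
  one bound finally suits all runs.\<close>

definition pdet :: "'a set \<Rightarrow> ('a \<Rightarrow> 'a \<Rightarrow> real) \<Rightarrow> real" where
  "pdet A M = (\<Sum>\<pi> | \<pi> permutes A. of_int (sign \<pi>) * (\<Prod>i\<in>A. M i (\<pi> i)))"

lemma pdet_cong:
  assumes "\<And>i j. i \<in> A \<Longrightarrow> j \<in> A \<Longrightarrow> M i j = N i j"
  shows "pdet A M = pdet A N"
  unfolding pdet_def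
  by (intro sum.cong refl arg_cong2[where f = "(*)"] prod.cong)
    (auto simp: assms permutes_in_image)

lemma pdet_empty [simp]: "pdet {} M = 1"
  by (simp add: pdet_def)

text \<open>Conjugation with \<open>f\<close> carries permutations of \<open>A\<close> to
  permutations of \<open>B\<close> and keeps the sign; no order on the indices is involved. This
  moves facts about determinants of matrices to arbitrary finite index sets, and removes the
  enumeration \<open>pick\<close> by which \<open>submatrix\<close> renumbers rows, so that minors
  of different sets share one indexing.\<close>

lemma pdet_reindex:
  assumes "finite A" "bij_betw f A B"
  shows "pdet B M = pdet A (\<lambda>i j. M (f i) (f j))"
proof -
  have inj: "inj_on f A" and B: "B = f ` A"
    using assms by (auto simp: bij_betw_def)
  \<comment> \<open>The sign is known for \<open>map_permutation\<close>, the bijection between the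
    permutations for the unfolded form; this equation joins the two.\<close>
  have eq: "map_permutation A f = (\<lambda>\<pi> x. if x \<in> B then f (\<pi> (inv_into A f x)) else x)"
    by (auto simp: fun_eq_iff map_permutation_def restrict_id_def B)
  have bij: "bij_betw (map_permutation A f) {\<pi>. \<pi> permutes A} {\<pi>. \<pi> permutes B}"
    unfolding eq by (rule bij_betw_permutations) fact
  show ?thesis
    unfolding pdet_def
  proof (subst sum.reindex_bij_betw[OF bij, symmetric], rule sum.cong[OF refl])
    fix \<pi> assume "\<pi> \<in> {\<pi>. \<pi> permutes A}"
    then have \<pi>: "\<pi> permutes A" by simp
    have "(\<Prod>i\<in>B. M i (map_permutation A f \<pi> i)) = (\<Prod>i\<in>A. M (f i) (map_permutation A f \<pi> (f i)))"
      unfolding B by (subst prod.reindex[OF inj]) simp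
    also have "\<dots> = (\<Prod>i\<in>A. M (f i) (f (\<pi> i)))"
      by (intro prod.cong) (auto simp: map_permutation_apply[OF inj])
    finally show "of_int (sign (map_permutation A f \<pi>)) * (\<Prod>i\<in>B. M i (map_permutation A f \<pi> i))
        = of_int (sign \<pi>) * (\<Prod>i\<in>A. M (f i) (f (\<pi> i)))"
      by (simp add: sign_map_permutation[OF inj \<pi> assms(1)])
  qed
qed

lemma det_mat_eq_pdet: "det (mat n n (\<lambda>(i, j). M i j)) = pdet {..<n} M"
proof -
  have "det (mat n n (\<lambda>(i, j). M i j)) =
      (\<Sum>\<pi> | \<pi> permutes {0..<n}. of_int (sign \<pi>) * (\<Prod>i = 0..<n. mat n n (\<lambda>(i, j). M i j) $$ (i, \<pi> i)))"
    by (subst det_def'[of _ n]) auto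
  also have "\<dots> = pdet {0..<n} M"
    unfolding pdet_def
    by (intro sum.cong refl arg_cong2[where f = "(*)"] prod.cong)
      (auto simp: permutes_in_image intro!: index_mat(1))
  finally show ?thesis by (simp add: atLeast0LessThan)
qed

lemma principal_minor_eq_pdet:
  assumes "L \<in> carrier_mat m m" "S \<subseteq> {..<m}"
  shows "principal_minor L S = pdet S (\<lambda>i j. L $$ (i, j))"
proof -
  have fin: "finite S" using assms(2) finite_subset by blast
  have "{i. i < m \<and> i \<in> S} = S" using assms(2) by auto
  then have "submatrix L S S = mat (card S) (card S) (\<lambda>(i, j). L $$ (pick S i, pick S j))"
    using assms(1) by (auto simp: submatrix_def)
  then have "principal_minor L S = pdet {..<card S} (\<lambda>i j. L $$ (pick S i, pick S j))"
    by (simp only: principal_minor_def det_mat_eq_pdet)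
  moreover have "bij_betw (pick S) {..<card S} S"
  proof (rule bij_betw_imageI)
    show inj: "inj_on (pick S) {..<card S}"
      by (rule linorder_inj_onI) (use pick_mono_le[of _ S] in \<open>fastforce simp: less_le\<close>)+
    have "pick S ` {..<card S} \<subseteq> S" using pick_in_set_le by auto
    then show "pick S ` {..<card S} = S"
      using card_image[OF inj] fin by (simp add: card_subset_eq)
  qed
  ultimately show ?thesis using pdet_reindex[of "{..<card S}" "pick S" S] by simp
qed

section \<open>Schur complements and diagonal perturbations\<close>

definition schur :: "'a \<Rightarrow> ('a \<Rightarrow> 'a \<Rightarrow> real) \<Rightarrow> 'a \<Rightarrow> 'a \<Rightarrow> real" where
  "schur k M i j = M i j - M i k * M k j / M k k"

text \<open>Block LU factorization with a pivot block of size one: with \<open>k\<close> numbered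
  first, the matrix is a unit lower triangular matrix times a block upper triangular one whose
  diagonal blocks are the pivot and the Schur complement.\<close>

lemma pdet_insert_schur:
  assumes "finite A" "k \<notin> A" "M k k \<noteq> 0"
  shows "pdet (insert k A) M = M k k * pdet A (schur k M)"
proof -
  define n where "n = card A"
  obtain g where g: "bij_betw g {..<n} A"
    using ex_bij_betw_nat_finite[OF assms(1)] by (auto simp: n_def atLeast0LessThan)
  define f where "f i = (case i of 0 \<Rightarrow> k | Suc i' \<Rightarrow> g i')" for i
  have "f ` {..<Suc n} = insert k A"
    using g by (auto simp: f_def bij_betw_def lessThan_Suc_eq_insert_0 image_image)
  moreover have "inj_on f {..<Suc n}"
    using g assms(2) unfolding lessThan_Suc_eq_insert_0
    by (auto simp: inj_on_def f_def bij_betw_def split: nat.splits)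
  ultimately have f: "bij_betw f {..<Suc n} (insert k A)" by (simp add: bij_betw_def)
  define N where "N i j = M (f i) (f j)" for i j
  define a where "a = mat 1 1 (\<lambda>_. M k k)"
  define r where "r = mat 1 n (\<lambda>(i, j). M k (g j))"
  define l where "l = mat n 1 (\<lambda>(i, j). M (g i) k / M k k)"
  define D where "D = mat n n (\<lambda>(i, j). schur k M (g i) (g j))"
  have car: "a \<in> carrier_mat 1 1" "r \<in> carrier_mat 1 n" "l \<in> carrier_mat n 1" "D \<in> carrier_mat n n"
    by (auto simp: a_def r_def l_def D_def)
  have "four_block_mat (1\<^sub>m 1) (0\<^sub>m 1 n) l (1\<^sub>m n) * four_block_mat a r (0\<^sub>m n 1) D
      = four_block_mat a r (l * a) (l * r + D)"
    by (subst mult_four_block_mat[OF one_carrier_mat zero_carrier_mat car(3) one_carrier_mat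
          car(1,2) zero_carrier_mat car(4)])
      (use car in auto)
  also have "\<dots> = mat (Suc n) (Suc n) (\<lambda>(i, j). N i j)"
    using assms(3)
    by (intro eq_matI)
      (auto simp: a_def r_def l_def D_def N_def f_def schur_def scalar_prod_def split: nat.splits)
  finally have "det (mat (Suc n) (Suc n) (\<lambda>(i, j). N i j))
      = det (four_block_mat (1\<^sub>m 1) (0\<^sub>m 1 n) l (1\<^sub>m n)) * det (four_block_mat a r (0\<^sub>m n 1) D)"
    using car by (metis (no_types, lifting) det_mult four_block_carrier_mat one_carrier_mat)
  also have "det (four_block_mat (1\<^sub>m 1) (0\<^sub>m 1 n) l (1\<^sub>m n)) = det (1\<^sub>m 1) * det (1\<^sub>m n)"
    by (rule det_four_block_mat_upper_right_zero[where n = 1 and m = n]) (use car in auto)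
  also have "det (four_block_mat a r (0\<^sub>m n 1) D) = det a * det D"
    by (rule det_four_block_mat_lower_left_zero[where n = 1 and m = n]) (use car in auto)
  also have "det a = M k k" by (simp add: a_def det_single)
  finally have "pdet {..<Suc n} N = M k k * det D" by (simp add: det_mat_eq_pdet)
  moreover have "det D = pdet A (schur k M)"
    unfolding D_def det_mat_eq_pdet by (rule pdet_reindex[symmetric]) (use g in auto)
  moreover have "pdet {..<Suc n} N = pdet (insert k A) M"
    unfolding N_def by (rule pdet_reindex[symmetric]) (use f in auto)
  ultimately show ?thesis by simp
qed

lemma pdet_zero_row:
  assumes "finite A" "k \<in> A" "\<And>j. j \<in> A \<Longrightarrow> M k j = 0"
  shows "pdet A M = 0"
  unfolding pdet_def
proof (rule sum.neutral, safe)
  fix \<pi> assume "\<pi> permutes A"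
  then have "M k (\<pi> k) = 0" using assms by (simp add: permutes_in_image)
  then show "of_int (sign \<pi>) * (\<Prod>i\<in>A. M i (\<pi> i)) = 0"
    using assms(1,2) by (auto intro!: prod_zero)
qed

text \<open>Multiplying out each product of the Leibniz formula chooses for every \<open>i\<close>
  either the entry of \<open>X\<close> or the diagonal term. The second choice vanishes unless the
  permutation fixes \<open>i\<close>, so what survives for a set \<open>S\<close> of first choices
  are the permutations of \<open>S\<close>.\<close>

lemma pdet_add_diagonal:
  assumes "finite A"
  shows "pdet A (\<lambda>i j. X i j + (if i = j then e i else 0))
    = (\<Sum>S\<in>Pow A. pdet S X * (\<Prod>i\<in>A - S. e i))"
proof -
  have "pdet A (\<lambda>i j. X i j + (if i = j then e i else 0)) =
     (\<Sum>\<pi> | \<pi> permutes A. \<Sum>S\<in>Pow A. of_int (sign \<pi>) *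
       ((\<Prod>i\<in>S. X i (\<pi> i)) * (\<Prod>i\<in>A - S. if i = \<pi> i then e i else 0)))"
    unfolding pdet_def by (simp add: prod_add[OF assms] sum_distrib_left)
  also have "\<dots> = (\<Sum>S\<in>Pow A. \<Sum>\<pi> | \<pi> permutes A. of_int (sign \<pi>) *
       ((\<Prod>i\<in>S. X i (\<pi> i)) * (\<Prod>i\<in>A - S. if i = \<pi> i then e i else 0)))"
    by (rule sum.swap)
  also have "\<dots> = (\<Sum>S\<in>Pow A. pdet S X * (\<Prod>i\<in>A - S. e i))"
  proof (rule sum.cong[OF refl])
    fix S assume S: "S \<in> Pow A"
    have "(\<Sum>\<pi> | \<pi> permutes A. of_int (sign \<pi>) *
         ((\<Prod>i\<in>S. X i (\<pi> i)) * (\<Prod>i\<in>A - S. if i = \<pi> i then e i else 0)))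
       = (\<Sum>\<pi> | \<pi> permutes S. of_int (sign \<pi>) *
         ((\<Prod>i\<in>S. X i (\<pi> i)) * (\<Prod>i\<in>A - S. if i = \<pi> i then e i else 0)))"
    proof (rule sum.mono_neutral_right)
      show "finite {\<pi>. \<pi> permutes A}" using assms by (rule finite_permutations)
      show "{\<pi>. \<pi> permutes S} \<subseteq> {\<pi>. \<pi> permutes A}" using S permutes_subset by blast
      show "\<forall>\<pi>\<in>{\<pi>. \<pi> permutes A} - {\<pi>. \<pi> permutes S}. of_int (sign \<pi>) *
         ((\<Prod>i\<in>S. X i (\<pi> i)) * (\<Prod>i\<in>A - S. if i = \<pi> i then e i else 0)) = 0"
      proof
        fix \<pi> assume \<pi>: "\<pi> \<in> {\<pi>. \<pi> permutes A} - {\<pi>. \<pi> permutes S}"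
        then have "\<exists>i\<in>A - S. i \<noteq> \<pi> i"
          using permutes_superset[of \<pi> A S] by force
        then have "(\<Prod>i\<in>A - S. if i = \<pi> i then e i else 0) = 0"
          using assms by (intro prod_zero) auto
        then show "of_int (sign \<pi>) *
         ((\<Prod>i\<in>S. X i (\<pi> i)) * (\<Prod>i\<in>A - S. if i = \<pi> i then e i else 0)) = 0" by simp
      qed
    qed
    also have "\<dots> = (\<Sum>\<pi> | \<pi> permutes S. of_int (sign \<pi>) * (\<Prod>i\<in>S. X i (\<pi> i)) * (\<Prod>i\<in>A - S. e i))"
    proof (rule sum.cong[OF refl], safe)
      fix \<pi> assume "\<pi> permutes S"
      then have "(\<Prod>i\<in>A - S. if i = \<pi> i then e i else 0) = (\<Prod>i\<in>A - S. e i)"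
        by (intro prod.cong) (auto simp: permutes_not_in)
      then show "of_int (sign \<pi>) * ((\<Prod>i\<in>S. X i (\<pi> i)) * (\<Prod>i\<in>A - S. if i = \<pi> i then e i else 0))
         = of_int (sign \<pi>) * (\<Prod>i\<in>S. X i (\<pi> i)) * (\<Prod>i\<in>A - S. e i)" by simp
    qed
    finally show "(\<Sum>\<pi> | \<pi> permutes A. of_int (sign \<pi>) *
         ((\<Prod>i\<in>S. X i (\<pi> i)) * (\<Prod>i\<in>A - S. if i = \<pi> i then e i else 0)))
       = pdet S X * (\<Prod>i\<in>A - S. e i)"
      by (simp add: pdet_def sum_distrib_right)
  qed
  finally show ?thesis .
qed

section \<open>Positive semidefinite forms on finite index sets\<close>

definition psd_on :: "'a set \<Rightarrow> ('a \<Rightarrow> 'a \<Rightarrow> real) \<Rightarrow> bool" where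
  "psd_on A M \<longleftrightarrow> (\<forall>i\<in>A. \<forall>j\<in>A. M i j = M j i) \<and> (\<forall>v. 0 \<le> (\<Sum>i\<in>A. \<Sum>j\<in>A. v i * M i j * v j))"

lemma psd_onD:
  "psd_on A M \<Longrightarrow> 0 \<le> (\<Sum>i\<in>A. \<Sum>j\<in>A. v i * M i j * v j)"
  unfolding psd_on_def by (elim conjE) (erule spec)

lemma psd_on_sym: "psd_on A M \<Longrightarrow> i \<in> A \<Longrightarrow> j \<in> A \<Longrightarrow> M i j = M j i"
  by (simp add: psd_on_def)

lemma psd_on_subset:
  assumes "psd_on A M" "B \<subseteq> A" "finite A"
  shows "psd_on B M"
  unfolding psd_on_def
proof (intro conjI allI)
  fix v :: "_ \<Rightarrow> real"
  let ?v = "\<lambda>i. if i \<in> B then v i else 0"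
  have "0 \<le> (\<Sum>i\<in>A. \<Sum>j\<in>A. ?v i * M i j * ?v j)"
    by (rule psd_onD[OF assms(1)])
  also have "\<dots> = (\<Sum>i\<in>B. \<Sum>j\<in>A. ?v i * M i j * ?v j)"
    by (rule sum.mono_neutral_right) (use assms in auto)
  also have "\<dots> = (\<Sum>i\<in>B. \<Sum>j\<in>B. ?v i * M i j * ?v j)"
    by (intro sum.cong refl sum.mono_neutral_right) (use assms in auto)
  finally show "0 \<le> (\<Sum>i\<in>B. \<Sum>j\<in>B. v i * M i j * v j)" by (simp cong: sum.cong)
qed (use psd_on_sym[OF assms(1)] assms(2) in blast)

lemma quadratic_form_insert:
  fixes M :: "'a \<Rightarrow> 'a \<Rightarrow> real"
  assumes "finite A" "k \<notin> A" "\<And>i. i \<in> A \<Longrightarrow> M i k = M k i"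
  shows "(\<Sum>i\<in>insert k A. \<Sum>j\<in>insert k A. v i * M i j * v j) =
    v k * v k * M k k + 2 * v k * (\<Sum>j\<in>A. M k j * v j) + (\<Sum>i\<in>A. \<Sum>j\<in>A. v i * M i j * v j)"
proof -
  have "(\<Sum>i\<in>A. v i * M i k * v k) = v k * (\<Sum>j\<in>A. M k j * v j)"
    unfolding sum_distrib_left by (intro sum.cong) (simp_all add: assms(3))
  moreover have "(\<Sum>j\<in>A. v k * M k j * v j) = v k * (\<Sum>j\<in>A. M k j * v j)"
    unfolding sum_distrib_left by (intro sum.cong) simp_all
  ultimately show ?thesis using assms(1,2) by (simp add: sum.distrib algebra_simps)
qed

lemma psd_on_diagonal_nonneg:
  assumes "psd_on A M" "k \<in> A" "finite A"
  shows "0 \<le> M k k"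
  using psd_onD[OF psd_on_subset[OF assms(1) _ assms(3), of "{k}"], of "\<lambda>_. 1"] assms(2) by simp

text \<open>On the coordinates \<open>k\<close> and \<open>j\<close>, a zero diagonal entry at
  \<open>k\<close> makes the form affine in the coordinate of \<open>k\<close>; an affine function
  bounded below is constant.\<close>

lemma psd_on_zero_row:
  assumes "psd_on A M" "finite A" "k \<in> A" "j \<in> A" "M k k = 0"
  shows "M k j = 0"
proof (cases "j = k")
  case False
  have sym: "M j k = M k j" using psd_on_sym assms by metis
  have "psd_on (insert k {j}) M" by (rule psd_on_subset[OF assms(1)]) (use assms in auto)
  then have *: "0 \<le> 2 * t * M k j + M j j" for t
    using quadratic_form_insert[of "{j}" k M "\<lambda>i. if i = k then t else 1"] False sym assms(5)
      psd_onD[of "{k, j}" M "\<lambda>i. if i = k then t else 1"] by simp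
  show ?thesis
  proof (rule ccontr)
    assume "M k j \<noteq> 0"
    \<comment> \<open>At this point the affine function takes the value -1.\<close>
    then show False using *[of "- (M j j + 1) / (2 * M k j)"] by (simp add: field_simps)
  qed
qed (use assms in simp)

text \<open>
  Since \<open>x / 0 = 0\<close>, this needs no assumption on the pivot: if it vanishes, then so does its row.
\<close>

lemma psd_on_schur:
  assumes "psd_on (insert k A) M" "finite A" "k \<notin> A"
  shows "psd_on A (schur k M)"
  unfolding psd_on_def
proof (intro conjI allI ballI)
  have sym: "M i j = M j i" if "i \<in> insert k A" "j \<in> insert k A" for i j
    using psd_on_sym[OF assms(1)] that by blast
  show "schur k M i j = schur k M j i" if "i \<in> A" "j \<in> A" for i j
    using that sym[of i j] sym[of i k] sym[of k j] by (simp add: schur_def)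
  fix v :: "_ \<Rightarrow> real"
  define s where "s = (\<Sum>j\<in>A. M k j * v j)"
  have s2: "(\<Sum>i\<in>A. \<Sum>j\<in>A. v i * (M i k * M k j / M k k) * v j) = s * s / M k k"
    unfolding s_def sum_product sum_divide_distrib
  proof (intro sum.cong refl)
    fix i j assume "i \<in> A" "j \<in> A"
    then show "v i * (M i k * M k j / M k k) * v j = M k i * v i * (M k j * v j) / M k k"
      using sym[of i k] by simp
  qed
  \<comment> \<open>For a positive pivot this value of coordinate \<open>k\<close> minimises the
    form, and completing the square leaves the form of the Schur complement. For a zero pivot the
    value and the correction \<open>s * s / M k k\<close> are both 0, so the same computation goes
    through.\<close>
  have "0 \<le> (\<Sum>i\<in>insert k A. \<Sum>j\<in>insert k A. (v(k := - s / M k k)) i * M i j * (v(k := - s / M k k)) j)"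
    by (rule psd_onD[OF assms(1)])
  also have "\<dots> = (s / M k k)\<^sup>2 * M k k - 2 * (s / M k k) * (\<Sum>j\<in>A. M k j * (v(k := - s / M k k)) j)
      + (\<Sum>i\<in>A. \<Sum>j\<in>A. (v(k := - s / M k k)) i * M i j * (v(k := - s / M k k)) j)"
    by (subst quadratic_form_insert) (use assms sym in \<open>auto simp: power2_eq_square\<close>)
  also have "(\<Sum>j\<in>A. M k j * (v(k := - s / M k k)) j) = s"
    unfolding s_def using assms(3) by (intro sum.cong) auto
  also have "(\<Sum>i\<in>A. \<Sum>j\<in>A. (v(k := - s / M k k)) i * M i j * (v(k := - s / M k k)) j) =
      (\<Sum>i\<in>A. \<Sum>j\<in>A. v i * M i j * v j)"
    using assms(3) by (intro sum.cong) auto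
  also have "(s / M k k)\<^sup>2 * M k k - 2 * (s / M k k) * s + (\<Sum>i\<in>A. \<Sum>j\<in>A. v i * M i j * v j) =
      (\<Sum>i\<in>A. \<Sum>j\<in>A. v i * M i j * v j) - s * s / M k k"
    by (simp add: power2_eq_square)
  also have "\<dots> = (\<Sum>i\<in>A. \<Sum>j\<in>A. v i * schur k M i j * v j)"
    unfolding schur_def s2[symmetric] sum_subtractf[symmetric]
    by (intro sum.cong refl) (simp add: algebra_simps)
  finally show "0 \<le> (\<Sum>i\<in>A. \<Sum>j\<in>A. v i * schur k M i j * v j)" .
qed

lemma pdet_insert_psd_on:
  assumes "psd_on (insert k A) M" "finite A" "k \<notin> A"
  shows "pdet (insert k A) M = M k k * pdet A (schur k M)"
proof (cases "M k k = 0")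
  case True
  then have "pdet (insert k A) M = 0"
    using psd_on_zero_row[OF assms(1)] assms(2) by (intro pdet_zero_row[of _ k]) auto
  then show ?thesis using True by simp
qed (rule pdet_insert_schur[OF assms(2,3)])

text \<open>Elimination keeps the remaining block positive semidefinite, so every pivot is a
  diagonal entry of such a block. The minors are the weights of the sampled distribution; their sign
  is what puts the toss biases into the unit interval.\<close>

lemma pdet_nonneg:
  assumes "finite A" "psd_on A M"
  shows "0 \<le> pdet A M"
  using assms
proof (induction A arbitrary: M rule: finite_induct)
  case (insert k A)
  have "0 \<le> M k k" using insert psd_on_diagonal_nonneg[of "insert k A" M k] by simp
  then show ?case
    using insert psd_on_schur[of k A M] by (simp add: pdet_insert_psd_on)
qed simp

text \<open>
  The elements of \<open>A\<close> are forced into the set, those of \<open>B\<close> out of it.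
\<close>

definition masked :: "(nat \<Rightarrow> nat \<Rightarrow> real) \<Rightarrow> nat set \<Rightarrow> nat set \<Rightarrow> (nat \<Rightarrow> real) \<Rightarrow> nat \<Rightarrow> nat \<Rightarrow> real" where
  "masked X A B e i j = X i j * of_bool (i \<notin> B) * of_bool (j \<notin> B) +
     (if i = j then e i * of_bool (i \<notin> A) else 0)"

text \<open>Clearing the rows and columns in \<open>B\<close> amounts to testing the old form on
  vectors with the coordinates in \<open>B\<close> set to zero; the diagonal part adds nonnegative
  multiples of squares.\<close>

lemma psd_on_masked:
  assumes "psd_on V X" "\<And>i. i \<in> V \<Longrightarrow> 0 \<le> e i" "finite V"
  shows "psd_on V (masked X A B e)"
  unfolding psd_on_def
proof (intro conjI ballI allI)
  show "masked X A B e i j = masked X A B e j i" if "i \<in> V" "j \<in> V" for i j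
    using psd_on_sym[OF assms(1) that] by (simp add: masked_def)
  fix v :: "nat \<Rightarrow> real"
  let ?v = "\<lambda>i. v i * of_bool (i \<notin> B)"
  have "v i * masked X A B e i j * v j = ?v i * X i j * ?v j +
      (if i = j then e i * of_bool (i \<notin> A) * (v i)\<^sup>2 else 0)" for i j
    by (simp add: masked_def power2_eq_square algebra_simps)
  then have "(\<Sum>i\<in>V. \<Sum>j\<in>V. v i * masked X A B e i j * v j) =
      (\<Sum>i\<in>V. \<Sum>j\<in>V. ?v i * X i j * ?v j) + (\<Sum>i\<in>V. e i * of_bool (i \<notin> A) * (v i)\<^sup>2)"
    using assms(3) by (simp add: sum.distrib)
  moreover have "0 \<le> (\<Sum>i\<in>V. \<Sum>j\<in>V. ?v i * X i j * ?v j)" by (rule psd_onD[OF assms(1)])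
  moreover have "0 \<le> (\<Sum>i\<in>V. e i * of_bool (i \<notin> A) * (v i)\<^sup>2)"
    using assms(2) by (intro sum_nonneg) simp
  ultimately show "0 \<le> (\<Sum>i\<in>V. \<Sum>j\<in>V. v i * masked X A B e i j * v j)" by simp
qed

text \<open>In the expansion along the diagonal, a set \<open>T\<close> that misses an element of
  \<open>A\<close> meets a vanishing diagonal factor, and a set that meets \<open>B\<close> has a
  zero row in its minor.\<close>

lemma pdet_masked:
  assumes "finite V" "A \<subseteq> V"
  shows "pdet V (masked X A B e) =
    (\<Sum>T | T \<subseteq> V \<and> A \<subseteq> T \<and> T \<inter> B = {}. pdet T X * (\<Prod>i\<in>V - T. e i))"
proof -
  let ?X = "\<lambda>i j. X i j * of_bool (i \<notin> B) * of_bool (j \<notin> B)"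
  have "pdet V (masked X A B e) =
      (\<Sum>T\<in>Pow V. pdet T ?X * (\<Prod>i\<in>V - T. e i * of_bool (i \<notin> A)))"
    unfolding pdet_add_diagonal[OF assms(1), symmetric] by (simp add: masked_def[abs_def])
  also have "\<dots> = (\<Sum>T | T \<subseteq> V \<and> A \<subseteq> T \<and> T \<inter> B = {}. pdet T ?X * (\<Prod>i\<in>V - T. e i * of_bool (i \<notin> A)))"
  proof (rule sum.mono_neutral_right)
    show "\<forall>T\<in>Pow V - {T. T \<subseteq> V \<and> A \<subseteq> T \<and> T \<inter> B = {}}.
        pdet T ?X * (\<Prod>i\<in>V - T. e i * of_bool (i \<notin> A)) = 0"
    proof
      fix T assume T: "T \<in> Pow V - {T. T \<subseteq> V \<and> A \<subseteq> T \<and> T \<inter> B = {}}"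
      then have fin: "finite T" using assms(1) finite_subset by blast
      consider i where "i \<in> A" "i \<notin> T" | i where "i \<in> T" "i \<in> B" using T by blast
      then show "pdet T ?X * (\<Prod>i\<in>V - T. e i * of_bool (i \<notin> A)) = 0"
      proof cases
        case 1
        then have "(\<Prod>i\<in>V - T. e i * of_bool (i \<notin> A)) = 0"
          using assms by (intro prod_zero) (auto intro!: bexI[of _ i])
        then show ?thesis by simp
      next
        case 2
        then have "pdet T ?X = 0" using fin by (intro pdet_zero_row[of _ i]) auto
        then show ?thesis by simp
      qed
    qed
  qed (use assms in auto)
  also have "\<dots> = (\<Sum>T | T \<subseteq> V \<and> A \<subseteq> T \<and> T \<inter> B = {}. pdet T X * (\<Prod>i\<in>V - T. e i))"
  proof (rule sum.cong[OF refl])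
    fix T assume T: "T \<in> {T. T \<subseteq> V \<and> A \<subseteq> T \<and> T \<inter> B = {}}"
    have "pdet T ?X = pdet T X" by (rule pdet_cong) (use T in auto)
    moreover have "(\<Prod>i\<in>V - T. e i * of_bool (i \<notin> A)) = (\<Prod>i\<in>V - T. e i)"
      by (rule prod.cong) (use T in auto)
    ultimately show "pdet T ?X * (\<Prod>i\<in>V - T. e i * of_bool (i \<notin> A)) = pdet T X * (\<Prod>i\<in>V - T. e i)"
      by simp
  qed
  finally show ?thesis .
qed

section \<open>Interpolation of the constraints\<close>

definition coeff_functional :: "nat \<Rightarrow> (nat \<Rightarrow> real) \<Rightarrow> real poly \<Rightarrow> real" where
  "coeff_functional N f q = (\<Sum>v\<le>N. Polynomial.coeff q v * f v)"

definition lagrange_basis :: "(nat \<Rightarrow> real) \<Rightarrow> nat \<Rightarrow> nat set \<Rightarrow> real poly" where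
  "lagrange_basis y s A = (\<Prod>k\<in>A. Polynomial.smult (1 / (y s - y k)) [:- y k, 1:])"

text \<open>The shift \<open>u\<close> and the partial node set \<open>A\<close> are there for the
  recurrence: while nodes are taken into \<open>A\<close> one by one, the values for the various
  \<open>u\<close> are the contents of an array of the program. The weights themselves are the
  values at \<open>u = 0\<close> with all nodes but \<open>s\<close> in \<open>A\<close>.\<close>

definition lagrange_functional ::
    "nat \<Rightarrow> (nat \<Rightarrow> real) \<Rightarrow> (nat \<Rightarrow> real) \<Rightarrow> nat \<Rightarrow> nat set \<Rightarrow> nat \<Rightarrow> real" where
  "lagrange_functional N f y s A u = coeff_functional N f (Polynomial.monom 1 u * lagrange_basis y s A)"

lemma coeff_functional_diff:
  "coeff_functional N f (p - q) = coeff_functional N f p - coeff_functional N f q"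
  by (simp add: coeff_functional_def sum_subtractf left_diff_distrib)

lemma coeff_functional_smult: "coeff_functional N f (Polynomial.smult a q) = a * coeff_functional N f q"
  by (simp add: coeff_functional_def sum_distrib_left mult.assoc)

lemma coeff_functional_sum:
  "coeff_functional N f (\<Sum>i\<in>A. g i) = (\<Sum>i\<in>A. coeff_functional N f (g i))"
  unfolding coeff_functional_def coeff_sum sum_distrib_right by (rule sum.swap)

lemma coeff_functional_monom:
  assumes "u \<le> N"
  shows "coeff_functional N f (Polynomial.monom 1 u) = f u"
proof -
  have "coeff_functional N f (Polynomial.monom 1 u) = (\<Sum>v\<le>N. if v = u then f v else 0)"
    unfolding coeff_functional_def by (intro sum.cong) (auto simp: coeff_monom)
  then show ?thesis using assms by simp
qed

lemma lagrange_functional_empty: "u \<le> N \<Longrightarrow> lagrange_functional N f y s {} u = f u"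
  by (simp add: lagrange_functional_def lagrange_basis_def coeff_functional_monom)

text \<open>One more linear factor sends \<open>t^u q\<close> to a combination of
  \<open>t^(u+1) q\<close> and \<open>t^u q\<close>. Thus a node is processed using neighbouring
  array entries only, and no polynomial is ever stored.\<close>

lemma lagrange_functional_insert:
  assumes "finite A" "k \<notin> A"
  shows "lagrange_functional N f y s (insert k A) u =
    (lagrange_functional N f y s A (Suc u) - y k * lagrange_functional N f y s A u) / (y s - y k)"
proof -
  let ?q = "lagrange_basis y s A"
  have "Polynomial.monom 1 u * lagrange_basis y s (insert k A) =
      Polynomial.smult (1 / (y s - y k)) (Polynomial.monom 1 (Suc u) * ?q - Polynomial.smult (y k) (Polynomial.monom 1 u * ?q))"
  proof -
    have *: "Polynomial.monom 1 u * (Polynomial.smult c [:- a, 1:] * q) =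
        Polynomial.smult c ([:- a, 1:] * (Polynomial.monom 1 u * q))" for c a :: real and q
      by (simp only: mult_smult_left mult_smult_right mult.left_commute)
    show ?thesis
      by (simp only: lagrange_basis_def prod.insert[OF assms] *) (simp add: monom_Suc)
  qed
  then show ?thesis
    by (simp add: lagrange_functional_def coeff_functional_diff coeff_functional_smult)
qed

text \<open>Lagrange interpolation of \<open>t\<^sup>u\<close>, under the functional that sends \<open>t\<^sup>v\<close> to \<open>f v\<close>.\<close>

lemma sum_lagrange_functional:
  assumes y: "inj_on y {..N}" and u: "u \<le> N"
  shows "(\<Sum>s\<le>N. lagrange_functional N f y s ({..N} - {s}) 0 * y s ^ u) = f u"
proof -
  let ?l = "\<lambda>s. lagrange_basis y s ({..N} - {s})"
  define P where "P = (\<Sum>s\<le>N. Polynomial.smult (y s ^ u) (?l s))"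
  have deg_l: "Polynomial.degree (?l s) \<le> N" if "s \<le> N" for s
  proof -
    have "Polynomial.degree (?l s) \<le> sum (Polynomial.degree \<circ> (\<lambda>k. Polynomial.smult (1 / (y s - y k)) [:- y k, 1:])) ({..N} - {s})"
      unfolding lagrange_basis_def by (rule degree_prod_sum_le) simp
    also have "\<dots> \<le> (\<Sum>k\<in>{..N} - {s}. 1)" by (intro sum_mono) (auto simp: degree_smult_eq)
    finally show ?thesis using that by simp
  qed
  have "P = Polynomial.monom 1 u"
  proof (rule poly_eqI_degree[where A = "y ` {..N}"])
    fix x assume "x \<in> y ` {..N}"
    then obtain t where t: "t \<le> N" "x = y t" by auto
    have l: "poly (?l s) (y t) = (if s = t then 1 else 0)" if "s \<le> N" for s
    proof (cases "s = t")
      case True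
      have "poly (?l s) (y t) = (\<Prod>k\<in>{..N} - {s}. 1)"
        unfolding lagrange_basis_def poly_prod True
      proof (rule prod.cong[OF refl])
        fix k assume "k \<in> {..N} - {t}"
        then have "y t \<noteq> y k" using y t(1) by (auto simp: inj_on_def)
        then show "poly (Polynomial.smult (1 / (y t - y k)) [:- y k, 1:]) (y t) = 1"
          by (simp add: diff_divide_distrib[symmetric])
      qed
      then show ?thesis using True by simp
    next
      case False
      have "poly (?l s) (y t) = 0"
        unfolding lagrange_basis_def poly_prod
        by (rule prod_zero) (use False t in \<open>auto intro!: bexI[of _ t]\<close>)
      then show ?thesis using False by simp
    qed
    have "poly P x = (\<Sum>s\<le>N. if s = t then y s ^ u else 0)"
      unfolding P_def poly_sum t(2) by (intro sum.cong) (simp_all add: l)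
    also have "\<dots> = y t ^ u" using t by simp
    finally show "poly P x = poly (Polynomial.monom 1 u) x" by (simp add: t poly_monom)
  next
    have "Polynomial.degree P \<le> N"
      unfolding P_def by (intro degree_sum_le) (auto intro: order.trans[OF degree_smult_le] deg_l)
    then show "card (y ` {..N}) > Polynomial.degree P" by (simp add: card_image[OF y])
    show "card (y ` {..N}) > Polynomial.degree (Polynomial.monom (1::real) u)"
      using u by (simp add: card_image[OF y] degree_monom_eq)
  qed
  then have "f u = coeff_functional N f P" by (simp add: coeff_functional_monom u)
  also have "\<dots> = (\<Sum>s\<le>N. lagrange_functional N f y s ({..N} - {s}) 0 * y s ^ u)"
    unfolding P_def coeff_functional_sum coeff_functional_smult lagrange_functional_def
    by (simp add: mult.commute)
  finally show ?thesis by simp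
qed

section \<open>Node weights that express a linear constraint\<close>

definition grid_node :: "nat \<Rightarrow> real" where
  "grid_node s = real s + 1"

text \<open>Distinct nodes would be enough for interpolation. Positivity, the reason for the shift
  by one, permits negative exponents and keeps the diagonal entries made from node powers
  positive.\<close>

lemma grid_node_pos: "0 < grid_node s"
  by (simp add: grid_node_def)

definition neg_part :: "nat \<Rightarrow> (nat \<Rightarrow> int) \<Rightarrow> nat" where
  "neg_part m c = (\<Sum>i<m. nat (- c i))"

definition pos_part :: "nat \<Rightarrow> (nat \<Rightarrow> int) \<Rightarrow> nat" where
  "pos_part m c = (\<Sum>i<m. nat (c i))"

lemma neg_part_plus_pos_part: "neg_part m c + pos_part m c = l1_norm m c"
  unfolding neg_part_def pos_part_def l1_norm_def sum.distrib[symmetric]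
  by (intro sum.cong) auto

text \<open>
  With \<open>u = neg_part m c + c([m] - S)\<close> one has \<open>0 \<le> u \<le> l1_norm m c\<close> and
  \<open>c(S) = pos_part m c - u\<close>, which is why the indicator is taken at \<open>pos_part m c - u\<close>.
\<close>

definition grid_weight :: "nat \<Rightarrow> (nat \<Rightarrow> int) \<Rightarrow> int set \<Rightarrow> nat \<Rightarrow> real" where
  "grid_weight m c K s = lagrange_functional (l1_norm m c)
     (\<lambda>u. of_bool (int (pos_part m c) - int u \<in> K)) grid_node s ({..l1_norm m c} - {s}) 0"

lemma sum_ge_neg_part:
  assumes "T \<subseteq> {..<m}"
  shows "- int (neg_part m c) \<le> (\<Sum>i\<in>T. c i)"
proof -
  have "- (\<Sum>i\<in>T. c i) = (\<Sum>i\<in>T. - c i)" by (simp add: sum_negf)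
  also have "\<dots> \<le> (\<Sum>i\<in>T. int (nat (- c i)))" by (intro sum_mono) auto
  also have "\<dots> \<le> (\<Sum>i<m. int (nat (- c i)))" by (intro sum_mono2) (use assms in auto)
  finally show ?thesis by (simp add: neg_part_def)
qed

lemma sum_le_pos_part:
  assumes "T \<subseteq> {..<m}"
  shows "(\<Sum>i\<in>T. c i) \<le> int (pos_part m c)"
proof -
  have "(\<Sum>i\<in>T. c i) \<le> (\<Sum>i\<in>T. int (nat (c i)))" by (intro sum_mono) auto
  also have "\<dots> \<le> (\<Sum>i<m. int (nat (c i)))" by (intro sum_mono2) (use assms in auto)
  finally show ?thesis by (simp add: pos_part_def)
qed

lemma sum_eq_pos_part_minus_neg_part: "(\<Sum>i<m. c i) = int (pos_part m c) - int (neg_part m c)"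
  unfolding pos_part_def neg_part_def of_nat_sum sum_subtractf[symmetric]
  by (intro sum.cong) auto

lemma prod_power_int_sum:
  fixes y :: real
  assumes "y \<noteq> 0" "finite A"
  shows "(\<Prod>i\<in>A. y powi c i) = y powi (\<Sum>i\<in>A. c i)"
  using assms(2) by (induction A rule: finite_induct) (simp_all add: power_int_add assms(1))

text \<open>The factors of the elements outside \<open>S\<close> multiply to one power of the node,
  and the prefactor with exponent \<open>neg_part m c\<close> makes the total exponent
  \<open>u\<close> a natural number that is at most \<open>l1_norm m c\<close>. The sum is then the
  interpolation identity for this \<open>u\<close>.\<close>

lemma sum_grid_weight:
  assumes "S \<subseteq> {..<m}"
  shows "(\<Sum>s\<le>l1_norm m c. grid_weight m c K s * grid_node s ^ neg_part m c *
      (\<Prod>i\<in>{..<m} - S. grid_node s powi c i)) = of_bool ((\<Sum>i\<in>S. c i) \<in> K)"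
proof -
  define u where "u = nat (int (neg_part m c) + (\<Sum>i\<in>{..<m} - S. c i))"
  have u: "int u = int (neg_part m c) + (\<Sum>i\<in>{..<m} - S. c i)"
    unfolding u_def using sum_ge_neg_part[of "{..<m} - S" m c] by simp
  then have "int u \<le> int (l1_norm m c)"
    using sum_le_pos_part[of "{..<m} - S" m c] neg_part_plus_pos_part[of m c] by simp
  then have le: "u \<le> l1_norm m c" by simp
  have pw: "grid_node s ^ neg_part m c * (\<Prod>i\<in>{..<m} - S. grid_node s powi c i) = grid_node s ^ u" for s
  proof -
    have "grid_node s ^ neg_part m c * (\<Prod>i\<in>{..<m} - S. grid_node s powi c i) =
        grid_node s powi (int (neg_part m c) + (\<Sum>i\<in>{..<m} - S. c i))"
      using grid_node_pos[of s] by (simp add: prod_power_int_sum power_int_add)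
    then show ?thesis by (simp flip: u)
  qed
  have "(\<Sum>i\<in>S. c i) + (\<Sum>i\<in>{..<m} - S. c i) = (\<Sum>i<m. c i)"
    using sum.subset_diff[OF assms, of c] by simp
  then have S: "int (pos_part m c) - int u = (\<Sum>i\<in>S. c i)"
    using u sum_eq_pos_part_minus_neg_part[of c m] by simp
  have "inj_on grid_node {..l1_norm m c}" by (auto simp: inj_on_def grid_node_def)
  from sum_lagrange_functional[OF this le,
      of "\<lambda>u. of_bool (int (pos_part m c) - int u \<in> K)"]
  show ?thesis by (simp add: grid_weight_def mult.assoc pw S)
qed

text \<open>
  The weights \<open>w r\<close> and factors \<open>d r i\<close>, for \<open>r\<close> in the window \<open>lo..<hi\<close>, write the indicator of \<open>P\<close>
  as a combination of functions that are multiplicative over the complement of \<open>S\<close>.  The factors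
  are positive in order that they may be added to the diagonal of a positive semidefinite matrix.
\<close>

definition grid_for ::
    "nat \<Rightarrow> (nat set \<Rightarrow> bool) \<Rightarrow> nat \<Rightarrow> nat \<Rightarrow> (nat \<Rightarrow> real) \<Rightarrow> (nat \<Rightarrow> nat \<Rightarrow> real) \<Rightarrow> bool" where
  "grid_for m P lo hi w d \<longleftrightarrow>
     (\<forall>r i. lo \<le> r \<longrightarrow> r < hi \<longrightarrow> i < m \<longrightarrow> 0 < d r i) \<and>
     (\<forall>S\<subseteq>{..<m}. (\<Sum>r = lo..<hi. w r * (\<Prod>i\<in>{..<m} - S. d r i)) = of_bool (P S))"

lemma sum_blocks:
  fixes g :: "nat \<Rightarrow> real"
  shows "(\<Sum>r = h..<h + n * W. g r) = (\<Sum>s<n. \<Sum>r<W. g (h + s * W + r))"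
proof (induction n)
  case (Suc n)
  have "(\<Sum>r = h..<h + Suc n * W. g r) =
      (\<Sum>r = h..<h + n * W. g r) + (\<Sum>r = h + n * W..<h + n * W + W. g r)"
    by (subst sum.atLeastLessThan_concat) (auto simp: algebra_simps)
  also have "(\<Sum>r = h + n * W..<h + n * W + W. g r) = (\<Sum>r<W. g (h + n * W + r))"
    using sum.shift_bounds_nat_ivl[of g 0 "h + n * W" W] by (simp add: atLeast0LessThan add_ac)
  finally show ?case by (simp add: Suc.IH)
qed simp

text \<open>The indicator of a conjunction is the product of the indicators, and a product of
  multiplicative functions is multiplicative. So the new grid consists of pairs of a node
  \<open>s\<close> and an old point \<open>r\<close>, one scaled copy of the old window per node;
  this is where the product of the numbers \<open>l1_norm + 1\<close> arises.\<close>

lemma grid_for_extend: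
  assumes "grid_for m P lo hi w d" "lo \<le> hi"
    and w': "\<And>s r. s \<le> l1_norm m c \<Longrightarrow> r < hi - lo \<Longrightarrow>
      w' (hi + s * (hi - lo) + r) = w (lo + r) * grid_weight m c K s * grid_node s ^ neg_part m c"
    and d': "\<And>s r i. s \<le> l1_norm m c \<Longrightarrow> r < hi - lo \<Longrightarrow> i < m \<Longrightarrow>
      d' (hi + s * (hi - lo) + r) i = d (lo + r) i * grid_node s powi c i"
  shows "grid_for m (\<lambda>S. P S \<and> (\<Sum>i\<in>S. c i) \<in> K) hi (hi + (l1_norm m c + 1) * (hi - lo)) w' d'"
  unfolding grid_for_def
proof (intro conjI allI impI)
  let ?W = "hi - lo" and ?N = "l1_norm m c"
  fix r i assume r: "hi \<le> r" "r < hi + (?N + 1) * ?W" "i < m"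
  then have "0 < ?W" by (cases ?W) auto
  define s t where "s = (r - hi) div ?W" and "t = (r - hi) mod ?W"
  have "r - hi < (?N + 1) * ?W" using r by auto
  then have "s < ?N + 1" unfolding s_def by (rule less_mult_imp_div_less)
  moreover have "t < ?W" using \<open>0 < ?W\<close> by (simp add: t_def)
  moreover have "r = hi + s * ?W + t"
    using div_mult_mod_eq[of "r - hi" ?W] r(1) unfolding s_def t_def by linarith
  moreover have "0 < d (lo + t) i" using assms(1) \<open>t < ?W\<close> r(3) by (auto simp: grid_for_def)
  ultimately show "0 < d' r i" using d'[of s t i] r(3) grid_node_pos[of s] by simp
next
  let ?W = "hi - lo" and ?N = "l1_norm m c"
  fix S assume S: "S \<subseteq> {..<m}"
  have "(\<Sum>r = hi..<hi + (?N + 1) * ?W. w' r * (\<Prod>i\<in>{..<m} - S. d' r i)) =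
    (\<Sum>s<?N + 1. \<Sum>r<?W. w' (hi + s * ?W + r) * (\<Prod>i\<in>{..<m} - S. d' (hi + s * ?W + r) i))"
    by (rule sum_blocks)
  also have "\<dots> = (\<Sum>s<?N + 1. \<Sum>r<?W.
      (grid_weight m c K s * grid_node s ^ neg_part m c * (\<Prod>i\<in>{..<m} - S. grid_node s powi c i)) *
      (w (lo + r) * (\<Prod>i\<in>{..<m} - S. d (lo + r) i)))"
    by (intro sum.cong refl) (simp add: w' d' prod.distrib mult_ac)
  also have "\<dots> = (\<Sum>s\<le>?N. grid_weight m c K s * grid_node s ^ neg_part m c *
      (\<Prod>i\<in>{..<m} - S. grid_node s powi c i)) * (\<Sum>r<?W. w (lo + r) * (\<Prod>i\<in>{..<m} - S. d (lo + r) i))"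
    by (simp add: sum_product lessThan_Suc_atMost)
  also have "(\<Sum>r<?W. w (lo + r) * (\<Prod>i\<in>{..<m} - S. d (lo + r) i)) =
      (\<Sum>r = lo..<hi. w r * (\<Prod>i\<in>{..<m} - S. d r i))"
    using sum.shift_bounds_nat_ivl[of "\<lambda>r. w r * (\<Prod>i\<in>{..<m} - S. d r i)" 0 lo ?W] assms(2)
    by (simp add: atLeast0LessThan add_ac)
  also have "\<dots> = of_bool (P S)" using assms(1) S by (simp add: grid_for_def)
  also note sum_grid_weight[OF S]
  finally show "(\<Sum>r = hi..<hi + (?N + 1) * ?W. w' r * (\<Prod>i\<in>{..<m} - S. d' r i)) =
      of_bool (P S \<and> (\<Sum>i\<in>S. c i) \<in> K)" by (simp only: of_bool_conj mult.commute)
qed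

text \<open>After exchanging the sums, the grid acts on each \<open>T\<close> separately and yields
  the indicator of \<open>P\<close>. The right-hand side is the unnormalized probability of the
  decisions recorded in \<open>A\<close> and \<open>B\<close>.\<close>

lemma sum_grid_pdet_masked:
  assumes "grid_for m P lo hi w d" "A \<subseteq> {..<m}"
  shows "(\<Sum>r = lo..<hi. w r * pdet {..<m} (masked X A B (d r))) =
    (\<Sum>T | T \<subseteq> {..<m} \<and> A \<subseteq> T \<and> T \<inter> B = {}. of_bool (P T) * pdet T X)"
proof -
  let ?I = "{T. T \<subseteq> {..<m} \<and> A \<subseteq> T \<and> T \<inter> B = {}}"
  have "(\<Sum>r = lo..<hi. w r * pdet {..<m} (masked X A B (d r))) =
      (\<Sum>r = lo..<hi. \<Sum>T\<in>?I. w r * (pdet T X * (\<Prod>i\<in>{..<m} - T. d r i)))"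
    by (simp add: pdet_masked[OF _ assms(2)] sum_distrib_left)
  also have "\<dots> = (\<Sum>T\<in>?I. \<Sum>r = lo..<hi. w r * (pdet T X * (\<Prod>i\<in>{..<m} - T. d r i)))"
    by (rule sum.swap)
  also have "\<dots> = (\<Sum>T\<in>?I. pdet T X * (\<Sum>r = lo..<hi. w r * (\<Prod>i\<in>{..<m} - T. d r i)))"
    unfolding sum_distrib_left by (intro sum.cong refl) (simp add: mult_ac)
  also have "\<dots> = (\<Sum>T\<in>?I. of_bool (P T) * pdet T X)"
    using assms(1) by (intro sum.cong refl) (simp add: grid_for_def)
  finally show ?thesis .
qed

lemma psd_mat_imp_psd_on:
  assumes "psd_mat m L"
  shows "psd_on {..<m} (\<lambda>i j. L $$ (i, j))"
  unfolding psd_on_def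
proof (intro conjI ballI allI)
  have L: "L \<in> carrier_mat m m" "transpose_mat L = L" using assms by (auto simp: psd_mat_def)
  show "L $$ (i, j) = L $$ (j, i)" if "i \<in> {..<m}" "j \<in> {..<m}" for i j
    using that L index_transpose_mat(1)[of i L j] by auto
  fix v :: "nat \<Rightarrow> real"
  have "0 \<le> scalar_prod (vec m v) (L *\<^sub>v vec m v)" using assms by (auto simp: psd_mat_def)
  also have "\<dots> = (\<Sum>i<m. v i * (\<Sum>j<m. L $$ (i, j) * v j))"
    using L(1) by (auto simp: scalar_prod_def atLeast0LessThan intro!: sum.cong)
  also have "\<dots> = (\<Sum>i<m. \<Sum>j<m. v i * L $$ (i, j) * v j)"
    by (simp add: sum_distrib_left mult.assoc)
  finally show "0 \<le> (\<Sum>i<m. \<Sum>j<m. v i * L $$ (i, j) * v j)" .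
qed

section \<open>Deterministic runs\<close>

primrec written :: "com \<Rightarrow> string set" where
  "written Skip = {}"
| "written (ISet x e) = {x}"
| "written (IPut a e1 e2 e) = {a}"
| "written (RSet x e) = {x}"
| "written (RPut a e1 e2 e) = {a}"
| "written (Toss x e) = {x}"
| "written (Seq c1 c2) = written c1 \<union> written c2"
| "written (Cond b c1 c2) = written c1 \<union> written c2"
| "written (While b c) = written c"

text \<open>A single set of names covers all four kinds of memory cells. This coarse frame loses
  nothing here, because the programs use each name for one kind of cell only.\<close>

definition same_except :: "string set \<Rightarrow> state \<Rightarrow> state \<Rightarrow> bool" where
  "same_except V \<sigma> \<tau> \<longleftrightarrow> (\<forall>x. x \<notin> V \<longrightarrow>
     ivar \<tau> x = ivar \<sigma> x \<and> iarr \<tau> x = iarr \<sigma> x \<and> rvar \<tau> x = rvar \<sigma> x \<and> rarr \<tau> x = rarr \<sigma> x)"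

lemma same_exceptD:
  assumes "same_except V \<sigma> \<tau>" "x \<notin> V"
  shows "ivar \<tau> x = ivar \<sigma> x" "iarr \<tau> x = iarr \<sigma> x" "rvar \<tau> x = rvar \<sigma> x" "rarr \<tau> x = rarr \<sigma> x"
  using assms by (auto simp: same_except_def)

lemma same_except_refl [simp]: "same_except V \<sigma> \<sigma>"
  by (simp add: same_except_def)

lemma same_except_trans: "same_except V \<sigma> \<tau> \<Longrightarrow> same_except V \<tau> \<upsilon> \<Longrightarrow> same_except V \<sigma> \<upsilon>"
  by (simp add: same_except_def)

lemma same_except_mono: "same_except V \<sigma> \<tau> \<Longrightarrow> V \<subseteq> W \<Longrightarrow> same_except W \<sigma> \<tau>"
  by (auto simp: same_except_def)

lemma same_except_ivar_update: "x \<in> V \<Longrightarrow> same_except V \<sigma> (\<sigma>\<lparr>ivar := (ivar \<sigma>)(x := v)\<rparr>)"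
  by (auto simp: same_except_def)

lemma Some_in_set_pmf_tick:
  "Some (\<tau>, t) \<in> set_pmf (tick s D) \<longleftrightarrow> (\<exists>t'. t = s + t' \<and> Some (\<tau>, t') \<in> set_pmf D)"
  unfolding tick_def set_map_pmf image_iff
  by (auto simp: eq_commute[of "Some (\<tau>, t)"] intro!: bexI)

lemma Some_in_set_pmf_and_then:
  "Some (\<tau>, t) \<in> set_pmf (and_then D f) \<longleftrightarrow>
    (\<exists>\<rho> t1 t2. Some (\<rho>, t1) \<in> set_pmf D \<and> Some (\<tau>, t2) \<in> set_pmf (f \<rho>) \<and> t = t1 + t2)"
proof -
  have "Some (\<tau>, t) \<in> set_pmf (and_then D f) \<longleftrightarrow>
    (\<exists>r\<in>set_pmf D. Some (\<tau>, t) \<in>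
      set_pmf (case r of None \<Rightarrow> return_pmf None | Some (\<sigma>, t) \<Rightarrow> tick t (f \<sigma>)))"
    by (simp add: and_then_def)
  also have "\<dots> \<longleftrightarrow> (\<exists>\<rho> t1. Some (\<rho>, t1) \<in> set_pmf D \<and> Some (\<tau>, t) \<in> set_pmf (tick t1 (f \<rho>)))"
    by (force split: option.splits)
  finally show ?thesis by (auto simp: Some_in_set_pmf_tick)
qed

lemma exec_same_except:
  "Some (\<tau>, t) \<in> set_pmf (exec orc n c \<sigma>) \<Longrightarrow> same_except (written c) \<sigma> \<tau>"
proof (induction orc n c \<sigma> arbitrary: \<tau> t rule: exec.induct)
  case (7 orc n c1 c2 \<sigma>)
  then obtain \<rho> t1 t2 where "Some (\<rho>, t1) \<in> set_pmf (exec orc n c1 \<sigma>)"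
    "Some (\<tau>, t2) \<in> set_pmf (exec orc n c2 \<rho>)"
    by (auto simp: Some_in_set_pmf_and_then)
  then have "same_except (written c1) \<sigma> \<rho>" "same_except (written c2) \<rho> \<tau>"
    using 7 by blast+
  then show ?case
    by (auto intro: same_except_trans[of _ _ \<rho>] elim: same_except_mono)
next
  case (8 orc n b c1 c2 \<sigma>)
  then show ?case
    by (auto simp: Some_in_set_pmf_tick intro: same_except_mono split: if_splits)
next
  case (10 orc n b c \<sigma>)
  show ?case
  proof (cases "bval orc b \<sigma>")
    case True
    with 10(3) obtain \<rho> t1 t2 where "Some (\<rho>, t1) \<in> set_pmf (exec orc n c \<sigma>)"
      "Some (\<tau>, t2) \<in> set_pmf (exec orc n (While b c) \<rho>)"
      by (auto simp: Some_in_set_pmf_and_then Some_in_set_pmf_tick)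
    with 10(1)[OF True] 10(2)[OF True] show ?thesis by (auto intro: same_except_trans[of _ _ \<rho>])
  qed (use 10(3) in \<open>auto simp: Some_in_set_pmf_tick\<close>)
qed (auto simp: same_except_def split: if_splits)

text \<open>A deterministic run is a point distribution that is the same for all large unrolling
  bounds. Demanding it for all large bounds, not for one, lets subprograms with different thresholds
  be composed.\<close>

definition runs :: "(int \<Rightarrow> int \<Rightarrow> bool) \<Rightarrow> com \<Rightarrow> state \<Rightarrow> (state \<Rightarrow> nat \<Rightarrow> bool) \<Rightarrow> bool" where
  "runs orc c \<sigma> Q \<longleftrightarrow>
    (\<exists>N \<tau> t. (\<forall>n\<ge>N. exec orc n c \<sigma> = return_pmf (Some (\<tau>, t))) \<and> Q \<tau> t)"

lemma runsI:
  "(\<And>n. exec orc n c \<sigma> = return_pmf (Some (\<tau>, t))) \<Longrightarrow> Q \<tau> t \<Longrightarrow> runs orc c \<sigma> Q"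
  unfolding runs_def by blast

text \<open>A consequence rule that also hands over the frame condition, so that specifications of
  subprograms need to mention only what is computed.\<close>

lemma runs_weaken:
  assumes "runs orc c \<sigma> P"
    and "\<And>\<tau> t. same_except (written c) \<sigma> \<tau> \<Longrightarrow> P \<tau> t \<Longrightarrow> Q \<tau> t"
  shows "runs orc c \<sigma> Q"
proof -
  obtain N \<tau> t where N: "\<And>n. n \<ge> N \<Longrightarrow> exec orc n c \<sigma> = return_pmf (Some (\<tau>, t))" "P \<tau> t"
    using assms(1) unfolding runs_def by blast
  have "same_except (written c) \<sigma> \<tau>"
    by (rule exec_same_except[of \<tau> t orc N]) (simp add: N(1))
  with assms(2) N show ?thesis unfolding runs_def by blast
qed

lemma runs_Skip: "Q \<sigma> 1 \<Longrightarrow> runs orc Skip \<sigma> Q"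
  by (rule runsI) auto

lemma runs_ISet:
  "Q (\<sigma>\<lparr>ivar := (ivar \<sigma>)(x := ival e \<sigma>)\<rparr>) (icost e + 1) \<Longrightarrow> runs orc (ISet x e) \<sigma> Q"
  by (rule runsI) auto

lemma runs_IPut:
  "Q (\<sigma>\<lparr>iarr := (iarr \<sigma>)(a := (iarr \<sigma> a)(ival e1 \<sigma> :=
        (iarr \<sigma> a (ival e1 \<sigma>))(ival e2 \<sigma> := ival e \<sigma>)))\<rparr>) (icost e1 + icost e2 + icost e + 1) \<Longrightarrow>
    runs orc (IPut a e1 e2 e) \<sigma> Q"
  by (rule runsI) auto

lemma runs_RSet:
  "Q (\<sigma>\<lparr>rvar := (rvar \<sigma>)(x := rval e \<sigma>)\<rparr>) (rcost e + 1) \<Longrightarrow> runs orc (RSet x e) \<sigma> Q"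
  by (rule runsI) auto

lemma runs_RPut:
  "Q (\<sigma>\<lparr>rarr := (rarr \<sigma>)(a := (rarr \<sigma> a)(ival e1 \<sigma> :=
        (rarr \<sigma> a (ival e1 \<sigma>))(ival e2 \<sigma> := rval e \<sigma>)))\<rparr>) (icost e1 + icost e2 + rcost e + 1) \<Longrightarrow>
    runs orc (RPut a e1 e2 e) \<sigma> Q"
  by (rule runsI) auto

lemma runs_Seq:
  assumes "runs orc c1 \<sigma> (\<lambda>\<rho> t1. runs orc c2 \<rho> (\<lambda>\<tau> t2. Q \<tau> (t1 + t2)))"
  shows "runs orc (Seq c1 c2) \<sigma> Q"
proof -
  obtain N1 \<rho> t1 where 1: "\<And>n. n \<ge> N1 \<Longrightarrow> exec orc n c1 \<sigma> = return_pmf (Some (\<rho>, t1))"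
    "runs orc c2 \<rho> (\<lambda>\<tau> t2. Q \<tau> (t1 + t2))"
    using assms unfolding runs_def by blast
  then obtain N2 \<tau> t2 where 2: "\<And>n. n \<ge> N2 \<Longrightarrow> exec orc n c2 \<rho> = return_pmf (Some (\<tau>, t2))"
    "Q \<tau> (t1 + t2)"
    unfolding runs_def by blast
  have "exec orc n (Seq c1 c2) \<sigma> = return_pmf (Some (\<tau>, t1 + t2))" if "n \<ge> max N1 N2" for n
    using that by (simp add: 1 2 and_then_def bind_return_pmf tick_def)
  with 2(2) show ?thesis unfolding runs_def by blast
qed

lemma runs_Cond:
  assumes "bval orc b \<sigma> \<Longrightarrow> runs orc c1 \<sigma> (\<lambda>\<tau> t. Q \<tau> (bcost b + t))"
    and "\<not> bval orc b \<sigma> \<Longrightarrow> runs orc c2 \<sigma> (\<lambda>\<tau> t. Q \<tau> (bcost b + t))"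
  shows "runs orc (Cond b c1 c2) \<sigma> Q"
proof -
  let ?c = "if bval orc b \<sigma> then c1 else c2"
  have "runs orc ?c \<sigma> (\<lambda>\<tau> t. Q \<tau> (bcost b + t))" using assms by simp
  then obtain N \<tau> t where 1: "\<And>n. n \<ge> N \<Longrightarrow> exec orc n ?c \<sigma> = return_pmf (Some (\<tau>, t))"
    "Q \<tau> (bcost b + t)"
    unfolding runs_def by blast
  have "exec orc n (Cond b c1 c2) \<sigma> = return_pmf (Some (\<tau>, bcost b + t))" if "n \<ge> N" for n
    using 1(1)[OF that] by (auto simp: tick_def split: if_splits)
  with 1(2) show ?thesis unfolding runs_def by blast
qed

lemma runs_While_False:
  assumes "\<not> bval orc b \<sigma>" "Q \<sigma> (bcost b)"
  shows "runs orc (While b c) \<sigma> Q"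
proof -
  have "exec orc n (While b c) \<sigma> = return_pmf (Some (\<sigma>, bcost b))" if n: "n \<ge> Suc 0" for n
    using n assms by (cases n) (simp_all add: tick_def)
  with assms(2) show ?thesis unfolding runs_def by blast
qed

lemma runs_While_True:
  assumes "bval orc b \<sigma>"
    and "runs orc c \<sigma> (\<lambda>\<rho> t1. runs orc (While b c) \<rho> (\<lambda>\<tau> t2. Q \<tau> (bcost b + (t1 + t2))))"
  shows "runs orc (While b c) \<sigma> Q"
proof -
  have "runs orc (Seq c (While b c)) \<sigma> (\<lambda>\<tau> t. Q \<tau> (bcost b + t))"
    by (rule runs_Seq) (use assms in simp)
  then obtain N \<tau> t where
    1: "\<And>n. n \<ge> N \<Longrightarrow> exec orc n (Seq c (While b c)) \<sigma> = return_pmf (Some (\<tau>, t))"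
    "Q \<tau> (bcost b + t)"
    unfolding runs_def by blast
  obtain n0 \<rho> t1 where n0: "\<And>n. n \<ge> n0 \<Longrightarrow> exec orc n c \<sigma> = return_pmf (Some (\<rho>, t1))"
    and "runs orc (While b c) \<rho> (\<lambda>\<tau> t2. Q \<tau> (bcost b + (t1 + t2)))"
    using assms(2) unfolding runs_def by blast
  then obtain n1 \<upsilon> t2 where n1: "\<And>n. n \<ge> n1 \<Longrightarrow> exec orc n (While b c) \<rho> = return_pmf (Some (\<upsilon>, t2))"
    and Q: "Q \<upsilon> (bcost b + (t1 + t2))"
    unfolding runs_def by blast
  \<comment> \<open>One unit of the bound pays for the unfolding; the body and the rest of the loop
    both get the remaining \<open>n'\<close>.\<close>
  have "exec orc n (While b c) \<sigma> = return_pmf (Some (\<upsilon>, bcost b + (t1 + t2)))"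
    if n: "n \<ge> Suc (max n0 n1)" for n
  proof -
    obtain n' where "n = Suc n'" "n' \<ge> n0" "n' \<ge> n1" using n by (cases n) auto
    then show ?thesis
      using assms(1) by (simp add: n0 n1 and_then_def bind_return_pmf tick_def)
  qed
  with Q show ?thesis unfolding runs_def by blast
qed

section \<open>Counting loops and their cost\<close>

definition For :: "string \<Rightarrow> iexp \<Rightarrow> iexp \<Rightarrow> com \<Rightarrow> com" where
  "For x a b c = Seq (ISet x a)
     (While (ILess (IVar x) b) (Seq c (ISet x (IAdd (IVar x) (IConst 1)))))"

lemma written_For [simp]: "written (For x a b c) = insert x (written c)"
  by (auto simp: For_def)

text \<open>The bound \<open>b\<close> is evaluated anew at every test, hence the hypothesis that it
  keeps the value \<open>h\<close> in all states the loop can reach. A pass costs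
  \<open>icost b + 2\<close> for the test and 4 for the increment; the first assignment and the
  last, failing test make up \<open>icost a + icost b + 3\<close>. The time \<open>T k\<close> may
  vary with \<open>k\<close>, because in the loop over the constraints most passes may be
  cheap.\<close>

lemma runs_For_sum:
  fixes T :: "nat \<Rightarrow> nat"
  assumes lo: "ival a \<sigma> = int l" and le: "l \<le> h"
    and hi: "\<And>\<tau>. same_except (insert x (written c)) \<sigma> \<tau> \<Longrightarrow> ival b \<tau> = int h"
    and x: "x \<notin> written c"
    and init: "I l (\<sigma>\<lparr>ivar := (ivar \<sigma>)(x := int l)\<rparr>)"
    and step: "\<And>k \<tau>. \<lbrakk>l \<le> k; k < h; same_except (insert x (written c)) \<sigma> \<tau>; ivar \<tau> x = int k; I k \<tau>\<rbrakk> \<Longrightarrow>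
        runs orc c \<tau> (\<lambda>\<upsilon> t. t \<le> T k \<and> I (Suc k) (\<upsilon>\<lparr>ivar := (ivar \<upsilon>)(x := int (Suc k))\<rparr>))"
    and post: "\<And>\<tau> t. \<lbrakk>same_except (insert x (written c)) \<sigma> \<tau>; I h \<tau>;
        t \<le> icost a + icost b + 3 + (\<Sum>k = l..<h. T k + icost b + 6)\<rbrakk> \<Longrightarrow> Q \<tau> t"
  shows "runs orc (For x a b c) \<sigma> Q"
proof -
  let ?V = "insert x (written c)"
  let ?w = "While (ILess (IVar x) b) (Seq c (ISet x (IAdd (IVar x) (IConst 1))))"
  have "runs orc ?w \<tau> (\<lambda>\<upsilon> t. same_except ?V \<sigma> \<upsilon> \<and> I h \<upsilon> \<and>
      t \<le> icost b + 2 + (\<Sum>k = k..<h. T k + icost b + 6))"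
    if "l \<le> k" "k \<le> h" "same_except ?V \<sigma> \<tau>" "ivar \<tau> x = int k" "I k \<tau>" for k \<tau>
    using that(2,1,3-)
  proof (induction k arbitrary: \<tau> rule: inc_induct)
    case base
    show ?case
      by (rule runs_While_False) (use base hi in auto)
  next
    case (step k)
    show ?case
    proof (rule runs_While_True)
      show "bval orc (ILess (IVar x) b) \<tau>" using step hi by simp
      show "runs orc (Seq c (ISet x (IAdd (IVar x) (IConst 1)))) \<tau> (\<lambda>\<rho> t1. runs orc ?w \<rho>
         (\<lambda>\<upsilon> t2. same_except ?V \<sigma> \<upsilon> \<and> I h \<upsilon> \<and>
           bcost (ILess (IVar x) b) + (t1 + t2) \<le> icost b + 2 + (\<Sum>k = k..<h. T k + icost b + 6)))"
      proof (rule runs_Seq, rule runs_weaken, rule assms(6))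
        fix \<rho> t1
        assume \<rho>: "same_except (written c) \<tau> \<rho>"
          "t1 \<le> T k \<and> I (Suc k) (\<rho>\<lparr>ivar := (ivar \<rho>)(x := int (Suc k))\<rparr>)"
        let ?\<rho> = "\<rho>\<lparr>ivar := (ivar \<rho>)(x := int (Suc k))\<rparr>"
        have xk: "ivar \<rho> x = int k" using same_exceptD(1)[OF \<rho>(1) x] step by simp
        have "same_except ?V \<sigma> ?\<rho>"
          using step.prems(2) same_except_mono[OF \<rho>(1), of ?V] same_except_ivar_update[of x ?V \<rho>]
          by (blast intro: same_except_trans)
        then have "runs orc ?w ?\<rho> (\<lambda>\<upsilon> t. same_except ?V \<sigma> \<upsilon> \<and> I h \<upsilon> \<and>
            t \<le> icost b + 2 + (\<Sum>k = Suc k..<h. T k + icost b + 6))"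
          using step \<rho>(2) by (intro step.IH) auto
        then have "runs orc ?w ?\<rho> (\<lambda>\<upsilon> t2. same_except ?V \<sigma> \<upsilon> \<and> I h \<upsilon> \<and>
            bcost (ILess (IVar x) b) + (t1 + 4 + t2) \<le> icost b + 2 + (\<Sum>k = k..<h. T k + icost b + 6))"
          by (rule runs_weaken) (use \<rho>(2) step.hyps in \<open>auto simp: sum.atLeast_Suc_lessThan\<close>)
        moreover have "int (Suc k) = int k + 1" by simp
        ultimately show "runs orc (ISet x (IAdd (IVar x) (IConst 1))) \<rho> (\<lambda>\<tau> t2. runs orc ?w \<tau>
          (\<lambda>\<upsilon> t2'. same_except ?V \<sigma> \<upsilon> \<and> I h \<upsilon> \<and>
            bcost (ILess (IVar x) b) + (t1 + t2 + t2') \<le> icost b + 2 + (\<Sum>k = k..<h. T k + icost b + 6)))"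
          by (intro runs_ISet) (simp add: xk add.assoc del: of_nat_Suc)
      qed (use step in auto)
    qed
  qed
  from this[of l "\<sigma>\<lparr>ivar := (ivar \<sigma>)(x := int l)\<rparr>"]
  have "runs orc ?w (\<sigma>\<lparr>ivar := (ivar \<sigma>)(x := int l)\<rparr>) (\<lambda>\<upsilon> t. same_except ?V \<sigma> \<upsilon> \<and> I h \<upsilon> \<and>
      t \<le> icost b + 2 + (\<Sum>k = l..<h. T k + icost b + 6))"
    using le init same_except_ivar_update[of x ?V \<sigma>] by simp
  then show ?thesis
    unfolding For_def
    by (intro runs_Seq runs_ISet) (auto simp: lo intro!: post elim: runs_weaken)
qed

lemma runs_For:
  fixes T :: nat
  assumes "ival a \<sigma> = int l" "l \<le> h"
    and "\<And>\<tau>. same_except (insert x (written c)) \<sigma> \<tau> \<Longrightarrow> ival b \<tau> = int h"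
    and "x \<notin> written c"
    and "I l (\<sigma>\<lparr>ivar := (ivar \<sigma>)(x := int l)\<rparr>)"
    and "\<And>k \<tau>. \<lbrakk>l \<le> k; k < h; same_except (insert x (written c)) \<sigma> \<tau>; ivar \<tau> x = int k; I k \<tau>\<rbrakk> \<Longrightarrow>
        runs orc c \<tau> (\<lambda>\<upsilon> t. t \<le> T \<and> I (Suc k) (\<upsilon>\<lparr>ivar := (ivar \<upsilon>)(x := int (Suc k))\<rparr>))"
    and post: "\<And>\<tau> t. \<lbrakk>same_except (insert x (written c)) \<sigma> \<tau>; I h \<tau>;
        t \<le> icost a + icost b + 3 + (h - l) * (T + icost b + 6)\<rbrakk> \<Longrightarrow> Q \<tau> t"
  shows "runs orc (For x a b c) \<sigma> Q"
  by (rule runs_For_sum[where T = "\<lambda>_. T" and I = I, OF assms(1-6)]) (auto intro!: post)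

section \<open>Evaluation of weighted sums of determinants\<close>

text \<open>
  In the programs, \<open>S\<close> marks the elements already chosen and \<open>E\<close> those already excluded; an element
  with neither mark is undecided.
\<close>

definition set_matrix :: com where
  "set_matrix = For ''i'' (IConst 0) (IVar ''m'')
    (Seq
      (For ''j'' (IConst 0) (IVar ''m'')
        (RPut ''M'' (IVar ''i'') (IVar ''j'')
          (RMul
            (RMul (RArr ''L'' (IVar ''i'') (IVar ''j''))
              (ROfInt (ISub (IConst 1) (IArr ''E'' (IConst 0) (IVar ''i'')))))
            (ROfInt (ISub (IConst 1) (IArr ''E'' (IConst 0) (IVar ''j'')))))))
      (RPut ''M'' (IVar ''i'') (IVar ''i'')
        (RAdd (RArr ''M'' (IVar ''i'') (IVar ''i''))
          (RMul (RArr ''d'' (IVar ''r'') (IVar ''i''))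
            (ROfInt (ISub (IConst 1) (IArr ''S'' (IConst 0) (IVar ''i''))))))))"

text \<open>The product of pivots starts from the weight of the grid point, so \<open>D\<close> ends
  as a finished summand. Updating in place is safe: both inner loops start at \<open>k + 1\<close>,
  so the pivot row and column keep the values that the step reads, and every other entry is read
  only when it is itself replaced.\<close>

definition eliminate :: com where
  "eliminate = Seq
    (RSet ''D'' (RArr ''w'' (IConst 0) (IVar ''r'')))
    (For ''k'' (IConst 0) (IVar ''m'')
      (Seq
        (RSet ''D'' (RMul (RVar ''D'') (RArr ''M'' (IVar ''k'') (IVar ''k''))))
        (For ''i'' (IAdd (IVar ''k'') (IConst 1)) (IVar ''m'')
          (For ''j'' (IAdd (IVar ''k'') (IConst 1)) (IVar ''m'')
            (RPut ''M'' (IVar ''i'') (IVar ''j'')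
              (RSub (RArr ''M'' (IVar ''i'') (IVar ''j''))
                (RDiv
                  (RMul (RArr ''M'' (IVar ''i'') (IVar ''k'')) (RArr ''M'' (IVar ''k'') (IVar ''j'')))
                  (RArr ''M'' (IVar ''k'') (IVar ''k'')))))))))"

definition evaluate :: com where
  "evaluate = Seq
    (RSet ''Z'' (ROfInt (IConst 0)))
    (For ''r'' (IVar ''lo'') (IVar ''hi'')
      (Seq set_matrix (Seq eliminate (RSet ''Z'' (RAdd (RVar ''Z'') (RVar ''D''))))))"

lemma written_set_matrix [simp]: "written set_matrix = {''i'', ''j'', ''M''}"
  by (auto simp: set_matrix_def)

lemma written_eliminate [simp]: "written eliminate = {''D'', ''k'', ''i'', ''j'', ''M''}"
  by (auto simp: eliminate_def)

lemma written_evaluate [simp]: "written evaluate = {''Z'', ''r'', ''D'', ''k'', ''i'', ''j'', ''M''}"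
  by (auto simp: evaluate_def)

definition masked_entry :: "state \<Rightarrow> int \<Rightarrow> int \<Rightarrow> real" where
  "masked_entry \<sigma> i j = rarr \<sigma> ''L'' i j *
     of_int (1 - iarr \<sigma> ''E'' 0 i) * of_int (1 - iarr \<sigma> ''E'' 0 j)"

definition diagonal_entry :: "state \<Rightarrow> int \<Rightarrow> real" where
  "diagonal_entry \<sigma> i = rarr \<sigma> ''d'' (ivar \<sigma> ''r'') i * of_int (1 - iarr \<sigma> ''S'' 0 i)"

lemma runs_set_matrix:
  assumes m: "ivar \<sigma> ''m'' = int m"
  shows "runs orc set_matrix \<sigma> (\<lambda>\<tau> t. t \<le> 100 * (m + 1)^2 \<and>
    (\<forall>i<m. \<forall>j<m. rarr \<tau> ''M'' (int i) (int j) =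
      masked_entry \<sigma> (int i) (int j) + (if i = j then diagonal_entry \<sigma> (int i) else 0)))"
  unfolding set_matrix_def
proof (rule runs_For[where l = 0 and h = m and T = "40 * m + 40" and
      I = "\<lambda>i \<tau>. rarr \<tau> ''M'' = (\<lambda>a b. if 0 \<le> a \<and> a < int i \<and> 0 \<le> b \<and> b < int m
        then masked_entry \<sigma> a b + (if a = b then diagonal_entry \<sigma> a else 0)
        else rarr \<sigma> ''M'' a b)"], goal_cases)
  case (6 i \<tau>)
  note se = 6(3) and i = 6(4) and I = 6(5)
  show ?case
  proof (rule runs_Seq, rule runs_For[where l = 0 and h = m and T = 25 and
        I = "\<lambda>j \<upsilon>. rarr \<upsilon> ''M'' =
          (\<lambda>a b. if a = int i \<and> 0 \<le> b \<and> b < int j then masked_entry \<sigma> a b else rarr \<tau> ''M'' a b)"],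
      goal_cases)
    case (6 j \<upsilon>)
    have "rarr \<upsilon> ''L'' = rarr \<sigma> ''L''" "iarr \<upsilon> ''E'' = iarr \<sigma> ''E''" "ivar \<upsilon> ''i'' = int i"
      using 6(3) se i by (simp_all add: same_except_def)
    then show ?case
      using 6(2,4,5) by (intro runs_RPut) (auto simp: fun_eq_iff masked_entry_def)
  next
    case (7 \<upsilon> t)
    have "rarr \<upsilon> ''d'' = rarr \<sigma> ''d''" "iarr \<upsilon> ''S'' = iarr \<sigma> ''S''" "ivar \<upsilon> ''i'' = int i"
      "ivar \<upsilon> ''r'' = ivar \<sigma> ''r''"
      using 7(1) se i by (simp_all add: same_except_def)
    then show ?case
      using 7(2,3) I i \<open>i < m\<close>
      by (intro runs_RPut) (auto simp: fun_eq_iff diagonal_entry_def)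
  qed (use se i in \<open>simp_all add: same_except_def m fun_eq_iff\<close>)
next
  case (7 \<tau> t)
  then show ?case by (auto simp: power2_eq_square algebra_simps)
qed (auto simp: same_except_def m fun_eq_iff)

text \<open>The matrix before step \<open>k\<close>. It describes the array of the program only
  where both indices are at least \<open>k\<close>, since the program leaves finished rows and
  columns alone while \<open>schur\<close> changes all entries.\<close>

primrec eliminated :: "(nat \<Rightarrow> nat \<Rightarrow> real) \<Rightarrow> nat \<Rightarrow> nat \<Rightarrow> nat \<Rightarrow> real" where
  "eliminated M 0 = M"
| "eliminated M (Suc k) = schur k (eliminated M k)"

lemma pdet_eq_prod_pivots:
  assumes "psd_on {..<m} M"
  shows "pdet {..<m} M = (\<Prod>k<m. eliminated M k k k)"
proof -
  \<comment> \<open>Semidefiniteness of the trailing block is carried along, since it licenses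
    splitting off the next pivot even when that pivot is zero.\<close>
  have "psd_on {k..<m} (eliminated M k) \<and>
      pdet {..<m} M = (\<Prod>l<k. eliminated M l l l) * pdet {k..<m} (eliminated M k)" if "k \<le> m" for k
    using that
  proof (induction k)
    case 0
    then show ?case using assms by (simp add: atLeast0LessThan)
  next
    case (Suc k)
    then have "{k..<m} = insert k {Suc k..<m}" by auto
    with Suc show ?case using psd_on_schur[of k "{Suc k..<m}"] by (simp add: pdet_insert_psd_on)
  qed
  from this[of m] show ?thesis by simp
qed

lemma runs_eliminate:
  assumes m: "ivar \<sigma> ''m'' = int m"
    and M: "\<And>i j. i < m \<Longrightarrow> j < m \<Longrightarrow> rarr \<sigma> ''M'' (int i) (int j) = M i j"
  shows "runs orc eliminate \<sigma> (\<lambda>\<tau> t. t \<le> 100 * (m + 1)^3 \<and>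
    rvar \<tau> ''D'' = rarr \<sigma> ''w'' 0 (ivar \<sigma> ''r'') * (\<Prod>k<m. eliminated M k k k))"
  unfolding eliminate_def
proof (rule runs_Seq, rule runs_RSet,
    rule runs_For[where l = 0 and h = m and T = "60 * (m + 1)^2" and
      I = "\<lambda>k \<tau>. rvar \<tau> ''D'' = rarr \<sigma> ''w'' 0 (ivar \<sigma> ''r'') * (\<Prod>l<k. eliminated M l l l) \<and>
        (\<forall>i j. k \<le> i \<and> i < m \<and> k \<le> j \<and> j < m \<longrightarrow>
          rarr \<tau> ''M'' (int i) (int j) = eliminated M k i j)"], goal_cases)
  case (6 k \<tau>)
  note se = 6(3) and k = 6(4) and I = 6(5)
  show ?case
  proof (rule runs_Seq, rule runs_RSet,
      rule runs_For[where l = "Suc k" and h = m and T = "45 * m + 20" and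
      I = "\<lambda>i \<upsilon>. rvar \<upsilon> ''D'' = rvar \<tau> ''D'' * rarr \<tau> ''M'' (int k) (int k) \<and>
        rarr \<upsilon> ''M'' = (\<lambda>a b. if int k < a \<and> a < int i \<and> int k < b \<and> b < int m
          then schur (int k) (rarr \<tau> ''M'') a b else rarr \<tau> ''M'' a b)"], goal_cases)
    case (6 i \<upsilon>)
    note se' = 6(3) and i = 6(4) and I' = 6(5)
    have k': "ivar \<upsilon> ''k'' = int k" using se' k by (simp add: same_except_def)
    show ?case
    proof (rule runs_For[where l = "Suc k" and h = m and T = 25 and
        I = "\<lambda>j \<phi>. rarr \<phi> ''M'' = (\<lambda>a b. if a = int i \<and> int k < b \<and> b < int j
            then schur (int k) (rarr \<tau> ''M'') a b else rarr \<upsilon> ''M'' a b)"], goal_cases)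
      case (6 j \<phi>)
      have "ivar \<phi> ''k'' = int k" "ivar \<phi> ''i'' = int i"
        using 6(3) k' i by (simp_all add: same_except_def)
      then show ?case
        using 6(1,2,4,5) I' \<open>Suc k \<le> i\<close> by (intro runs_RPut) (auto simp: fun_eq_iff schur_def)
    next
      case (7 \<phi> t)
      then show ?case
        using I' \<open>Suc k \<le> i\<close> by (auto simp: fun_eq_iff same_except_def algebra_simps)
    qed (use se se' k' \<open>k < m\<close> in \<open>simp_all add: same_except_def m fun_eq_iff\<close>)
  next
    case (7 \<upsilon> t)
    have "(m - Suc k) * (45 * m + 27) \<le> m * (45 * m + 27)" by simp
    then show ?case
      using 7 I \<open>k < m\<close> by (auto simp: schur_def power2_eq_square algebra_simps)
  qed (use se k \<open>k < m\<close> in \<open>simp_all add: same_except_def m fun_eq_iff\<close>)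
next
  case (7 \<tau> t)
  then show ?case by (auto simp: power2_eq_square power3_eq_cube algebra_simps)
qed (auto simp: same_except_def m M)

lemma runs_evaluate:
  assumes m: "ivar \<sigma> ''m'' = int m" and lo: "ivar \<sigma> ''lo'' = int lo" and hi: "ivar \<sigma> ''hi'' = int hi"
    and le: "lo \<le> hi"
    and N: "\<And>r i j. lo \<le> r \<Longrightarrow> r < hi \<Longrightarrow> i < m \<Longrightarrow> j < m \<Longrightarrow> N r i j = masked_entry \<sigma> (int i) (int j) +
      (if i = j then rarr \<sigma> ''d'' (int r) (int i) * of_int (1 - iarr \<sigma> ''S'' 0 (int i)) else 0)"
    and psd: "\<And>r. lo \<le> r \<Longrightarrow> r < hi \<Longrightarrow> psd_on {..<m} (N r)"
  shows "runs orc evaluate \<sigma> (\<lambda>\<tau> t. t \<le> 300 * (m + 1)^3 * (hi - lo + 1) \<and>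
    rvar \<tau> ''Z'' = (\<Sum>r = lo..<hi. rarr \<sigma> ''w'' 0 (int r) * pdet {..<m} (N r)))"
  unfolding evaluate_def
proof (rule runs_Seq, rule runs_RSet,
    rule runs_For[where l = lo and h = hi and T = "250 * (m + 1)^3" and
      I = "\<lambda>r \<tau>. rvar \<tau> ''Z'' = (\<Sum>r = lo..<r. rarr \<sigma> ''w'' 0 (int r) * pdet {..<m} (N r))"], goal_cases)
  case (6 r \<tau>)
  note se = 6(3) and r = 6(4) and I = 6(5)
  have masked: "masked_entry \<tau> = masked_entry \<sigma>" using se
    by (simp add: masked_entry_def[abs_def] same_except_def)
  have diag: "diagonal_entry \<tau> i = rarr \<sigma> ''d'' (int r) i * of_int (1 - iarr \<sigma> ''S'' 0 i)" for i
    using se r by (simp add: diagonal_entry_def same_except_def)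
  show ?case
  proof (rule runs_Seq, rule runs_weaken, rule runs_set_matrix[of _ m], goal_cases)
    case 1
    then show ?case using se by (simp add: same_except_def m)
  next
    case (2 \<upsilon> t)
    have Nr: "i < m \<Longrightarrow> j < m \<Longrightarrow> rarr \<upsilon> ''M'' (int i) (int j) = N r i j" for i j
      using 2(2) N[OF \<open>lo \<le> r\<close> \<open>r < hi\<close>] by (simp add: masked diag)
    show ?case
    proof (rule runs_Seq, rule runs_weaken, rule runs_eliminate[of _ m "N r"], goal_cases)
      case 1
      then show ?case using se 2(1) by (simp add: same_except_def m)
    next
      case (3 \<phi> t')
      have "(m + 1)^2 \<le> (m + 1)^3" "1 \<le> (m + 1)^3" by (rule power_increasing, auto)
      with conjunct1[OF 2(2)] conjunct1[OF 3(2)] have "t + t' + 4 \<le> 250 * (m + 1)^3" by linarith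
      moreover have "rvar \<phi> ''D'' = rarr \<sigma> ''w'' 0 (int r) * pdet {..<m} (N r)"
        using 3 se 2(1) r pdet_eq_prod_pivots[OF psd[OF \<open>lo \<le> r\<close> \<open>r < hi\<close>]]
        by (simp add: same_except_def)
      moreover have "rvar \<phi> ''Z'' = (\<Sum>r = lo..<r. rarr \<sigma> ''w'' 0 (int r) * pdet {..<m} (N r))"
        using 3 2(1) I by (simp add: same_except_def)
      ultimately show ?case
        using \<open>lo \<le> r\<close> by (intro runs_RSet) (simp add: add.assoc del: power_Suc)
    qed (rule Nr)
  qed
next
  case (7 \<tau> t)
  \<comment> \<open>The 3 is for clearing \<open>Z\<close>, the 5 for entering and leaving the loop,
    the 7 for the overhead of each pass.\<close>
  have "3 + (5 + W * (7 + 250 * q)) \<le> 300 * q * (W + 1)" if "1 \<le> q" for q W :: nat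
  proof -
    have "300 * q * (W + 1) = 300 * (q * W) + 300 * q" "W * (7 + 250 * q) = 250 * (q * W) + 7 * W"
      by (simp_all add: algebra_simps)
    then show ?thesis using that mult_le_mono1[OF that, of W] by linarith
  qed
  from this[of "(m + 1)^3" "hi - lo"] have "3 + t \<le> 300 * (m + 1)^3 * (hi - lo + 1)"
    using 7(3) by (auto simp del: power_Suc intro: order_trans[rotated])
  with 7(2) show ?case by simp
qed (use le in \<open>simp_all add: same_except_def lo hi\<close>)

section \<open>Construction of the grid\<close>

definition split_row :: com where
  "split_row = Seq (ISet ''a'' (IConst 0)) (Seq (ISet ''b'' (IConst 0))
    (For ''i'' (IConst 0) (IVar ''m'')
      (Cond (ILess (IArr ''c'' (IVar ''j'') (IVar ''i'')) (IConst 0))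
        (ISet ''a'' (ISub (IVar ''a'') (IArr ''c'' (IVar ''j'') (IVar ''i''))))
        (ISet ''b'' (IAdd (IVar ''b'') (IArr ''c'' (IVar ''j'') (IVar ''i'')))))))"

text \<open>Entry \<open>u\<close> of \<open>h\<close> starts as the indicator at
  \<open>b - u\<close>, and each node other than \<open>s\<close> applies the recurrence for one
  more Lagrange factor. Ascending \<open>u\<close> may work in place, as entry \<open>u\<close>
  reads only \<open>u\<close> and \<open>u + 1\<close>. Every such pass makes the valid prefix one
  shorter, until entry 0 alone is left, which is the weight. Two negated comparisons stand for the
  test \<open>k = s\<close>.\<close>

definition compute_weight :: com where
  "compute_weight = Seq
    (For ''u'' (IConst 0) (IAdd (IAdd (IVar ''a'') (IVar ''b'')) (IConst 1))
      (Cond (InK (IVar ''j'') (ISub (IVar ''b'') (IVar ''u'')))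
        (RPut ''h'' (IConst 0) (IVar ''u'') (ROfInt (IConst 1)))
        (RPut ''h'' (IConst 0) (IVar ''u'') (ROfInt (IConst 0)))))
    (For ''k'' (IConst 0) (IAdd (IAdd (IVar ''a'') (IVar ''b'')) (IConst 1))
      (Cond (BAnd (BNot (ILess (IVar ''k'') (IVar ''s''))) (BNot (ILess (IVar ''s'') (IVar ''k''))))
        Skip
        (For ''u'' (IConst 0) (IAdd (IVar ''a'') (IVar ''b''))
          (RPut ''h'' (IConst 0) (IVar ''u'')
            (RDiv
              (RSub (RArr ''h'' (IConst 0) (IAdd (IVar ''u'') (IConst 1)))
                (RMul (ROfInt (IAdd (IVar ''k'') (IConst 1))) (RArr ''h'' (IConst 0) (IVar ''u''))))
              (ROfInt (ISub (IVar ''s'') (IVar ''k''))))))))"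

text \<open>Arrays accept negative indices, so \<open>q\<close> holds the power of the node with
  exponent \<open>z\<close> at place \<open>z\<close>, for either sign. A cost can then serve as an
  index, and no power has to be computed per element and grid point.\<close>

definition compute_powers :: com where
  "compute_powers = Seq
    (RPut ''q'' (IConst 0) (IConst 0) (ROfInt (IConst 1)))
    (For ''u'' (IConst 0) (IAdd (IVar ''a'') (IVar ''b''))
      (Seq
        (RPut ''q'' (IConst 0) (IAdd (IVar ''u'') (IConst 1))
          (RMul (RArr ''q'' (IConst 0) (IVar ''u'')) (ROfInt (IAdd (IVar ''s'') (IConst 1)))))
        (RPut ''q'' (IConst 0) (ISub (IConst 0) (IAdd (IVar ''u'') (IConst 1)))
          (RDiv (ROfInt (IConst 1)) (RArr ''q'' (IConst 0) (IAdd (IVar ''u'') (IConst 1)))))))"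

text \<open>The counter \<open>e\<close> stands for the target index
  \<open>hi + s * (hi - lo) + (r - lo)\<close>, which the machine could not compute by a product.
  The entry of \<open>q\<close> at \<open>a\<close> is the prefactor that makes all exponents
  nonnegative.\<close>

definition append_block :: com where
  "append_block = For ''r'' (IVar ''lo'') (IVar ''hi'')
    (Seq
      (RPut ''w'' (IConst 0) (IVar ''e'')
        (RMul (RMul (RArr ''w'' (IConst 0) (IVar ''r'')) (RArr ''h'' (IConst 0) (IConst 0)))
          (RArr ''q'' (IConst 0) (IVar ''a''))))
      (Seq
        (For ''i'' (IConst 0) (IVar ''m'')
          (RPut ''d'' (IVar ''e'') (IVar ''i'')
            (RMul (RArr ''d'' (IVar ''r'') (IVar ''i''))
              (RArr ''q'' (IConst 0) (IArr ''c'' (IVar ''j'') (IVar ''i''))))))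
        (ISet ''e'' (IAdd (IVar ''e'') (IConst 1)))))"

text \<open>
  The refined grid is appended behind the current window \<open>lo..<hi\<close>, which only then is moved, so that
  nothing has to be copied.
\<close>

definition refine_grid :: com where
  "refine_grid = Seq (ISet ''e'' (IVar ''hi''))
    (Seq
      (For ''s'' (IConst 0) (IAdd (IAdd (IVar ''a'') (IVar ''b'')) (IConst 1))
        (Seq compute_weight (Seq compute_powers append_block)))
      (Seq (ISet ''lo'' (IVar ''hi'')) (ISet ''hi'' (IVar ''e''))))"

text \<open>One point with weight 1 and all factors 1 represents the condition that is always
  true.\<close>

definition start_grid :: com where
  "start_grid = Seq (ISet ''lo'' (IConst 0)) (Seq (ISet ''hi'' (IConst 1))
    (Seq (RPut ''w'' (IConst 0) (IConst 0) (ROfInt (IConst 1)))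
      (For ''i'' (IConst 0) (IVar ''m'')
        (RPut ''d'' (IConst 0) (IVar ''i'') (ROfInt (IConst 1))))))"

text \<open>
  Zero cost vectors are skipped: there may be many more of them than the grid has points.  Their
  constraints hold automatically, because the family is not empty.
\<close>

definition build_grid :: com where
  "build_grid = Seq start_grid
    (For ''j'' (IConst 0) (IVar ''p'')
      (Seq split_row
        (Cond (ILess (IConst 0) (IAdd (IVar ''a'') (IVar ''b''))) refine_grid Skip)))"

lemma written_split_row [simp]: "written split_row = {''a'', ''b'', ''i''}"
  by (auto simp: split_row_def)

lemma written_compute_weight [simp]: "written compute_weight = {''u'', ''k'', ''h''}"
  by (auto simp: compute_weight_def)

lemma written_compute_powers [simp]: "written compute_powers = {''u'', ''q''}"
  by (auto simp: compute_powers_def)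

lemma written_append_block [simp]: "written append_block = {''r'', ''w'', ''i'', ''d'', ''e''}"
  by (auto simp: append_block_def)

lemma written_refine_grid [simp]: "written refine_grid =
    {''e'', ''s'', ''u'', ''k'', ''h'', ''q'', ''r'', ''w'', ''i'', ''d'', ''lo'', ''hi''}"
  by (auto simp: refine_grid_def)

lemma written_start_grid [simp]: "written start_grid = {''lo'', ''hi'', ''w'', ''i'', ''d''}"
  by (auto simp: start_grid_def)

lemma runs_split_row:
  assumes m: "ivar \<sigma> ''m'' = int m"
    and c: "\<And>i. i < m \<Longrightarrow> iarr \<sigma> ''c'' (ivar \<sigma> ''j'') (int i) = c i"
  shows "runs orc split_row \<sigma> (\<lambda>\<tau> t. t \<le> 40 * (m + 1) \<and>
    ivar \<tau> ''a'' = int (neg_part m c) \<and> ivar \<tau> ''b'' = int (pos_part m c))"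
  unfolding split_row_def
proof (rule runs_Seq, rule runs_ISet, rule runs_Seq, rule runs_ISet,
    rule runs_For[where l = 0 and h = m and T = 20 and
      I = "\<lambda>i \<tau>. ivar \<tau> ''a'' = int (neg_part i c) \<and> ivar \<tau> ''b'' = int (pos_part i c)"], goal_cases)
  case (6 i \<tau>)
  have "iarr \<tau> ''c'' (ivar \<tau> ''j'') (int i) = c i"
    using 6(3) c[OF 6(2)] by (simp add: same_except_def)
  then show ?case
    using 6(4,5) by (intro runs_Cond runs_ISet) (auto simp: neg_part_def pos_part_def)
qed (auto simp: same_except_def m neg_part_def pos_part_def)

lemma runs_compute_weight:
  fixes f :: "nat \<Rightarrow> real"
  assumes a: "ivar \<sigma> ''a'' = int a" and b: "ivar \<sigma> ''b'' = int b" and s: "ivar \<sigma> ''s'' = int s"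
    and f: "\<And>u. f u = of_bool (orc (ivar \<sigma> ''j'') (int b - int u))"
    and N: "N = a + b" "s \<le> N"
  shows "runs orc compute_weight \<sigma> (\<lambda>\<tau> t. t \<le> 100 * (N + 1)^2 \<and>
    rarr \<tau> ''h'' 0 0 = lagrange_functional N f grid_node s ({..N} - {s}) 0)"
proof -
  let ?lf = "lagrange_functional N f grid_node s"
  let ?A = "\<lambda>k. {..<k} - {s}"
  have bound: "ival (IAdd (IAdd (IVar ''a'') (IVar ''b'')) (IConst 1)) \<tau> = int (N + 1)"
    if "same_except V \<sigma> \<tau>" "''a'' \<notin> V" "''b'' \<notin> V" for \<tau> V
    using that by (simp add: same_except_def a b N)
  show ?thesis
    unfolding compute_weight_def
  proof (rule runs_Seq, rule runs_For[where l = 0 and h = "N + 1" and T = 15 and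
        I = "\<lambda>u \<tau>. \<forall>v<u. rarr \<tau> ''h'' 0 (int v) = f v"], goal_cases)
    case (6 u \<tau>)
    have "ivar \<tau> ''j'' = ivar \<sigma> ''j''" "ivar \<tau> ''b'' = int b"
      using 6(3) by (simp_all add: same_except_def b)
    then show ?case
      using 6(4,5) by (intro runs_Cond runs_RPut) (auto simp: less_Suc_eq f)
  next
    case (7 \<tau> t)
    note se = 7(1) and t = 7(3)
    have h: "u \<le> N \<Longrightarrow> rarr \<tau> ''h'' 0 (int u) = f u" for u using 7(2) by simp
    show ?case
    proof (rule runs_For[where l = 0 and h = "N + 1" and T = "40 * N + 30" and
        I = "\<lambda>k \<tau>. \<forall>u. u + card (?A k) \<le> N \<longrightarrow> rarr \<tau> ''h'' 0 (int u) = ?lf (?A k) u"], goal_cases)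
      case (6 k \<upsilon>)
      note se' = 6(3) and k = 6(4) and I = 6(5)
      have s': "ivar \<upsilon> ''s'' = int s" using se se' by (simp add: same_except_def s)
      show ?case
      proof (rule runs_Cond, goal_cases)
        case 1
        then have "k = s" by (simp add: k s')
        then have "?A (Suc k) = ?A k" by auto
        with I show ?case by (intro runs_Skip) simp
      next
        case 2
        then have ks: "k \<noteq> s" by (auto simp: k s')
        then have A: "?A (Suc k) = insert k (?A k)" "k \<notin> ?A k" by auto
        then have card: "card (?A (Suc k)) = Suc (card (?A k))" by simp
        have rec: "?lf (?A (Suc k)) u = (?lf (?A k) (Suc u) - (real k + 1) * ?lf (?A k) u) / (real s - real k)" for u
          unfolding A(1) by (subst lagrange_functional_insert) (simp_all add: grid_node_def)
        show ?case
        proof (rule runs_For[where l = 0 and h = N and T = 25 and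
            I = "\<lambda>u \<tau>. rarr \<tau> ''h'' 0 = (\<lambda>z. if 0 \<le> z \<and> z < int u
              then (rarr \<upsilon> ''h'' 0 (z + 1) - (real k + 1) * rarr \<upsilon> ''h'' 0 z) / (real s - real k)
              else rarr \<upsilon> ''h'' 0 z)"], goal_cases)
          case (6 u \<phi>)
          have "ivar \<phi> ''k'' = int k" "ivar \<phi> ''s'' = int s"
            using 6(3) k s' by (simp_all add: same_except_def)
          then show ?case
            using 6(4,5) by (intro runs_RPut) (auto simp: fun_eq_iff)
        next
          case (7 \<phi> t')
          have "rarr \<phi> ''h'' 0 (int u) = ?lf (?A (Suc k)) u" if "u + card (?A (Suc k)) \<le> N" for u
          proof -
            have "rarr \<upsilon> ''h'' 0 (int u) = ?lf (?A k) u" "rarr \<upsilon> ''h'' 0 (int (Suc u)) = ?lf (?A k) (Suc u)"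
              using I[rule_format, of u] I[rule_format, of "Suc u"] that card by simp_all
            then show ?thesis
              using that card unfolding 7(2) rec by (simp add: add.commute)
          qed
          with 7(3) show ?case by simp
        qed (use se se' in \<open>simp_all add: same_except_def a b N fun_eq_iff\<close>)
      qed
    next
      case (7 \<upsilon> t')
      \<comment> \<open>With \<open>N\<close> factors applied, the invariant speaks about entry 0
        only.\<close>
      have "?A (N + 1) = {..N} - {s}" "card (?A (N + 1)) = N" using N(2) by auto
      moreover have "rarr \<upsilon> ''h'' 0 (int 0) = ?lf (?A (N + 1)) 0"
        using 7(2)[rule_format, of 0] calculation by simp
      ultimately show ?case
        using 7(3) t by (simp add: power2_eq_square algebra_simps)
    qed (use se h lagrange_functional_empty in \<open>simp_all add: same_except_def a b N\<close>)
  qed (simp_all add: same_except_def a b N)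
qed

lemma runs_compute_powers:
  assumes a: "ivar \<sigma> ''a'' = int a" and b: "ivar \<sigma> ''b'' = int b" and s: "ivar \<sigma> ''s'' = int s"
    and N: "N = a + b"
  shows "runs orc compute_powers \<sigma> (\<lambda>\<tau> t. t \<le> 60 * (N + 1) \<and>
    (\<forall>z. \<bar>z\<bar> \<le> int N \<longrightarrow> rarr \<tau> ''q'' 0 z = grid_node s powi z))"
  unfolding compute_powers_def
proof (rule runs_Seq, rule runs_RPut,
    rule runs_For[where l = 0 and h = N and T = 40 and
      I = "\<lambda>u \<tau>. \<forall>z. \<bar>z\<bar> \<le> int u \<longrightarrow> rarr \<tau> ''q'' 0 z = grid_node s powi z"], goal_cases)
  case (6 u \<tau>)
  have \<tau>: "ivar \<tau> ''s'' = int s" "ivar \<tau> ''u'' = int u"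
    using 6(3,4) s by (simp_all add: same_except_def)
  have q: "rarr \<tau> ''q'' 0 (int u) = grid_node s ^ u" using 6(5) by simp
  have pos: "grid_node s ^ u * (real s + 1) = grid_node s powi (int u + 1)"
    using grid_node_pos[of s] by (simp add: power_int_add) (simp add: grid_node_def)
  have "1 / grid_node s powi (int u + 1) = grid_node s powi (- (int u + 1))"
    by (simp only: power_int_minus_divide)
  then have neg: "1 / grid_node s powi (int u + 1) = grid_node s powi (- int u - 1)" by simp
  have old: "rarr \<tau> ''q'' 0 z = grid_node s powi z"
    if "\<bar>z\<bar> \<le> 1 + int u" "z \<noteq> int u + 1" "z \<noteq> - int u - 1" for z
    using 6(5) that by auto
  show ?case
    by (intro runs_Seq runs_RPut) (simp add: \<tau> q pos neg old)
next
  case (7 \<tau> t)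
  then show ?case by simp
qed (use s in \<open>auto simp: same_except_def a b N\<close>)

lemma runs_append_block:
  assumes m: "ivar \<sigma> ''m'' = int m" and lo: "ivar \<sigma> ''lo'' = int lo" and hi: "ivar \<sigma> ''hi'' = int hi"
    and e: "ivar \<sigma> ''e'' = int e" and le: "lo \<le> hi" "hi \<le> e"
  defines "w \<equiv> rarr \<sigma> ''w'' 0" and "d \<equiv> rarr \<sigma> ''d''" and "q \<equiv> rarr \<sigma> ''q'' 0"
    and "h \<equiv> rarr \<sigma> ''h'' 0 0" and "c \<equiv> iarr \<sigma> ''c'' (ivar \<sigma> ''j'')"
  shows "runs orc append_block \<sigma> (\<lambda>\<tau> t. t \<le> 100 * (m + 1) * (hi - lo + 1) \<and>
    ivar \<tau> ''e'' = int (e + (hi - lo)) \<and>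
    (\<forall>x<e. rarr \<tau> ''w'' 0 (int x) = w (int x) \<and> rarr \<tau> ''d'' (int x) = d (int x)) \<and>
    (\<forall>r<hi - lo. rarr \<tau> ''w'' 0 (int (e + r)) = w (int (lo + r)) * h * q (ivar \<sigma> ''a'') \<and>
      (\<forall>i<m. rarr \<tau> ''d'' (int (e + r)) (int i) = d (int (lo + r)) (int i) * q (c (int i)))))"
  unfolding append_block_def
proof (rule runs_For[where l = lo and h = hi and T = "25 * m + 50" and
      I = "\<lambda>r \<tau>. ivar \<tau> ''e'' = int (e + (r - lo)) \<and>
        (\<forall>x<e. rarr \<tau> ''w'' 0 (int x) = w (int x) \<and> rarr \<tau> ''d'' (int x) = d (int x)) \<and>
        (\<forall>r'<r - lo. rarr \<tau> ''w'' 0 (int (e + r')) = w (int (lo + r')) * h * q (ivar \<sigma> ''a'') \<and>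
          (\<forall>i<m. rarr \<tau> ''d'' (int (e + r')) (int i) = d (int (lo + r')) (int i) * q (c (int i))))"],
    goal_cases)
  case (6 r \<tau>)
  note se = 6(3) and r = 6(4)
  have I: "ivar \<tau> ''e'' = int (e + (r - lo))"
    "\<And>x. x < e \<Longrightarrow> rarr \<tau> ''w'' 0 (int x) = w (int x)"
    "\<And>x. x < e \<Longrightarrow> rarr \<tau> ''d'' (int x) = d (int x)"
    "\<And>r'. r' < r - lo \<Longrightarrow> rarr \<tau> ''w'' 0 (int (e + r')) = w (int (lo + r')) * h * q (ivar \<sigma> ''a'')"
    "\<And>r' i. r' < r - lo \<Longrightarrow> i < m \<Longrightarrow>
      rarr \<tau> ''d'' (int (e + r')) (int i) = d (int (lo + r')) (int i) * q (c (int i))"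
    using 6(5) by blast+
  \<comment> \<open>The row being copied lies below the first free row, so no write of this block
    has touched it.\<close>
  have re: "r < e" "lo + (r - lo) = r" using 6(1,2) le by auto
  have const: "rarr \<tau> ''h'' 0 0 = h" "rarr \<tau> ''q'' 0 = q" "ivar \<tau> ''a'' = ivar \<sigma> ''a''"
    using se by (simp_all add: same_except_def h_def q_def)
  show ?case
  proof (rule runs_Seq, rule runs_RPut, rule runs_Seq,
      rule runs_For[where l = 0 and h = m and T = 15 and
        I = "\<lambda>i \<upsilon>. rarr \<upsilon> ''d'' = (rarr \<tau> ''d'')(int (e + (r - lo)) :=
          (\<lambda>z. if 0 \<le> z \<and> z < int i then d (int r) z * q (c z) else rarr \<tau> ''d'' (int (e + (r - lo))) z))"],
      goal_cases)
    case (6 i \<upsilon>)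
    have "ivar \<upsilon> ''r'' = int r" "ivar \<upsilon> ''e'' = int (e + (r - lo))" "rarr \<upsilon> ''q'' 0 = q"
      "iarr \<upsilon> ''c'' (ivar \<upsilon> ''j'') = c"
      using 6(3) se r I(1) by (simp_all add: same_except_def q_def c_def)
    moreover have "rarr \<upsilon> ''d'' (int r) = d (int r)"
      using 6(5) I(3)[OF re(1)] re by simp
    ultimately show ?case
      using 6(4,5) by (intro runs_RPut) (auto simp: fun_eq_iff)
  next
    case (7 \<upsilon> t)
    have e': "ivar \<upsilon> ''e'' = int (e + (r - lo))" using 7(1) I(1) by (simp add: same_except_def)
    have w': "rarr \<upsilon> ''w'' 0 = (rarr \<tau> ''w'' 0)(int (e + (r - lo)) := w (int r) * h * q (ivar \<sigma> ''a''))"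
      using 7(1) I(1) I(2)[OF re(1)] r by (simp add: same_except_def const)
    have d': "rarr \<upsilon> ''d'' = (rarr \<tau> ''d'')(int (e + (r - lo)) :=
        (\<lambda>z. if 0 \<le> z \<and> z < int m then d (int r) z * q (c z) else rarr \<tau> ''d'' (int (e + (r - lo))) z))"
      using 7(2) .
    have "Suc r - lo = Suc (r - lo)" using 6(1) by simp
    moreover have "rarr \<upsilon> ''w'' 0 (int x) = w (int x) \<and> rarr \<upsilon> ''d'' (int x) = d (int x)" if "x < e" for x
      using I(2,3)[OF that] that by (simp add: w' d')
    moreover have "rarr \<upsilon> ''w'' 0 (int (e + r')) = w (int (lo + r')) * h * q (ivar \<sigma> ''a'') \<and>
          (\<forall>i<m. rarr \<upsilon> ''d'' (int (e + r')) (int i) = d (int (lo + r')) (int i) * q (c (int i)))"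
      if "r' < Suc (r - lo)" for r'
    proof (cases "r' = r - lo")
      case True
      then show ?thesis unfolding True w' d' re(2) by simp
    next
      case False
      then have ne: "int (e + r') \<noteq> int (e + (r - lo))" by simp
      have "r' < r - lo" using that False by simp
      then show ?thesis unfolding w' d' fun_upd_other[OF ne] using I(4,5)[of r'] by blast
    qed
    ultimately show ?case
      using 7(3) by (intro runs_ISet) (simp add: e')
  qed (use se I in \<open>simp_all add: same_except_def m fun_eq_iff\<close>)
next
  case (7 \<tau> t)
  then show ?case by (simp add: algebra_simps)
qed (use le in \<open>simp_all add: same_except_def lo hi e w_def d_def\<close>)

section \<open>Refinement of the grid and its total time\<close>

definition ready ::
    "nat \<Rightarrow> (nat \<Rightarrow> nat \<Rightarrow> real) \<Rightarrow> (nat set \<Rightarrow> bool) \<Rightarrow> nat \<Rightarrow> nat \<Rightarrow> state \<Rightarrow> bool" where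
  "ready m X P lo hi \<sigma> \<longleftrightarrow> lo \<le> hi \<and> ivar \<sigma> ''m'' = int m \<and> ivar \<sigma> ''lo'' = int lo \<and>
     ivar \<sigma> ''hi'' = int hi \<and> (\<forall>i<m. \<forall>j<m. rarr \<sigma> ''L'' (int i) (int j) = X i j) \<and>
     grid_for m P lo hi (\<lambda>r. rarr \<sigma> ''w'' 0 (int r)) (\<lambda>r i. rarr \<sigma> ''d'' (int r) (int i))"

lemma ready_same_except:
  assumes "same_except V \<sigma> \<tau>" "V \<inter> {''m'', ''lo'', ''hi'', ''L'', ''w'', ''d''} = {}"
  shows "ready m X P lo hi \<tau> = ready m X P lo hi \<sigma>"
  using assms unfolding ready_def same_except_def by simp

text \<open>By this the constraint of a zero cost vector joins the represented condition while the
  grid stays as it is.\<close>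

lemma ready_cong:
  assumes "\<And>S. S \<subseteq> {..<m} \<Longrightarrow> P S = Q S"
  shows "ready m X P lo hi \<sigma> = ready m X Q lo hi \<sigma>"
  using assms by (simp add: ready_def grid_for_def)

lemma abs_le_l1_norm: "i < m \<Longrightarrow> \<bar>c i\<bar> \<le> int (l1_norm m c)"
proof -
  assume "i < m"
  then have "nat \<bar>c i\<bar> \<le> l1_norm m c" unfolding l1_norm_def by (intro member_le_sum) auto
  then show ?thesis by linarith
qed

lemma runs_refine_grid:
  assumes \<sigma>: "ready m X P lo hi \<sigma>"
    and ab: "ivar \<sigma> ''a'' = int (neg_part m c)" "ivar \<sigma> ''b'' = int (pos_part m c)"
    and K: "\<And>x. orc (ivar \<sigma> ''j'') x \<longleftrightarrow> x \<in> K"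
    and c: "\<And>i. i < m \<Longrightarrow> iarr \<sigma> ''c'' (ivar \<sigma> ''j'') (int i) = c i"
    and B: "l1_norm m c + 1 \<le> B" "hi - lo \<le> B"
  shows "runs orc refine_grid \<sigma> (\<lambda>\<tau> t. t \<le> 500 * (m + 1) * B^3 \<and>
    ready m X (\<lambda>S. P S \<and> (\<Sum>i\<in>S. c i) \<in> K) hi (hi + (l1_norm m c + 1) * (hi - lo)) \<tau>)"
proof -
  define N W where "N = l1_norm m c" and "W = hi - lo"
  define w d where "w r = rarr \<sigma> ''w'' 0 (int r)" and "d r i = rarr \<sigma> ''d'' (int r) (int i)" for r i
  \<comment> \<open>Time for one node: the bounds for its weight, for its table of powers and for
    its block, in this order.\<close>
  define T where "T = 100 * (N + 1)^2 + 60 * (N + 1) + 100 * (m + 1) * (W + 1)"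
  have N: "N = neg_part m c + pos_part m c" by (simp add: N_def neg_part_plus_pos_part)
  have vars: "ivar \<sigma> ''m'' = int m" "ivar \<sigma> ''lo'' = int lo" "ivar \<sigma> ''hi'' = int hi" "lo \<le> hi"
    and L: "\<And>i j. i < m \<Longrightarrow> j < m \<Longrightarrow> rarr \<sigma> ''L'' (int i) (int j) = X i j"
    and grid: "grid_for m P lo hi w d"
    using \<sigma> by (simp_all add: ready_def w_def[abs_def] d_def[abs_def])
  let ?V = "{''s'', ''u'', ''k'', ''h'', ''q'', ''r'', ''w'', ''i'', ''d'', ''e''}"
  show ?thesis
    unfolding refine_grid_def
  proof (rule runs_Seq, rule runs_ISet, rule runs_Seq,
      rule runs_For[where l = 0 and h = "N + 1" and T = T and
        I = "\<lambda>s \<tau>. ivar \<tau> ''e'' = int (hi + s * W) \<and>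
          (\<forall>x<hi. rarr \<tau> ''w'' 0 (int x) = w x \<and> (\<forall>i. rarr \<tau> ''d'' (int x) (int i) = d x i)) \<and>
          (\<forall>s'<s. \<forall>r<W. rarr \<tau> ''w'' 0 (int (hi + s' * W + r)) =
              w (lo + r) * grid_weight m c K s' * grid_node s' ^ neg_part m c \<and>
            (\<forall>i<m. rarr \<tau> ''d'' (int (hi + s' * W + r)) (int i) = d (lo + r) i * grid_node s' powi c i))"],
      goal_cases)
    case (6 s \<tau>)
    have se: "same_except ?V \<sigma> \<tau>"
      using 6(3) by (simp add: same_except_def)
    have I: "ivar \<tau> ''e'' = int (hi + s * W)"
      "\<And>x. x < hi \<Longrightarrow> rarr \<tau> ''w'' 0 (int x) = w x"
      "\<And>x i. x < hi \<Longrightarrow> rarr \<tau> ''d'' (int x) (int i) = d x i"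
      "\<And>s' r. s' < s \<Longrightarrow> r < W \<Longrightarrow> rarr \<tau> ''w'' 0 (int (hi + s' * W + r)) =
              w (lo + r) * grid_weight m c K s' * grid_node s' ^ neg_part m c"
      "\<And>s' r i. s' < s \<Longrightarrow> r < W \<Longrightarrow> i < m \<Longrightarrow>
          rarr \<tau> ''d'' (int (hi + s' * W + r)) (int i) = d (lo + r) i * grid_node s' powi c i"
      using 6(5) by blast+
    show ?case
    proof (rule runs_Seq, rule runs_weaken,
        rule runs_compute_weight[where a = "neg_part m c" and b = "pos_part m c" and s = s and N = N and
          f = "\<lambda>u. of_bool (int (pos_part m c) - int u \<in> K)"], goal_cases)
      case (7 \<upsilon> t1)
      have se\<upsilon>: "same_except ?V \<sigma> \<upsilon>" "ivar \<upsilon> ''s'' = int s"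
        using se 7(1) 6(4) by (simp_all add: same_except_def)
      have h: "rarr \<upsilon> ''h'' 0 0 = grid_weight m c K s"
        using 7(2) by (simp add: grid_weight_def N_def)
      show ?case
      proof (rule runs_Seq, rule runs_weaken,
          rule runs_compute_powers[where a = "neg_part m c" and b = "pos_part m c" and s = s and N = N],
          goal_cases)
        case (5 \<phi> t2)
        have se\<phi>: "same_except ?V \<sigma> \<phi>" using se\<upsilon> 5(1) by (simp add: same_except_def)
        have w\<phi>: "rarr \<phi> ''w'' = rarr \<tau> ''w''" and d\<phi>: "rarr \<phi> ''d'' = rarr \<tau> ''d''"
          and h\<phi>: "rarr \<phi> ''h'' 0 0 = grid_weight m c K s"
          using 5(1) 7(1) h by (simp_all add: same_except_def)
        have q: "rarr \<phi> ''q'' 0 (ivar \<phi> ''a'') = grid_node s ^ neg_part m c"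
          "i < m \<Longrightarrow> rarr \<phi> ''q'' 0 (iarr \<phi> ''c'' (ivar \<phi> ''j'') (int i)) = grid_node s powi c i" for i
          using 5(2) se\<phi> c[of i] abs_le_l1_norm[of i m c] ab(1)
          by (simp_all add: same_except_def N N_def[symmetric])
        show ?case
        proof (rule runs_weaken,
            rule runs_append_block[where m = m and lo = lo and hi = hi and e = "hi + s * W"], goal_cases)
          case (7 \<psi> t3)
          have e: "ivar \<psi> ''e'' = int (hi + Suc s * W)" using 7(2) by (simp add: W_def)
          have old: "rarr \<psi> ''w'' 0 (int x) = rarr \<tau> ''w'' 0 (int x)"
            "rarr \<psi> ''d'' (int x) = rarr \<tau> ''d'' (int x)" if "x < hi + s * W" for x
            using 7(2) that by (simp_all add: w\<phi> d\<phi>)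
          have new: "rarr \<psi> ''w'' 0 (int (hi + s * W + r)) =
              w (lo + r) * grid_weight m c K s * grid_node s ^ neg_part m c"
            "i < m \<Longrightarrow> rarr \<psi> ''d'' (int (hi + s * W + r)) (int i) = d (lo + r) i * grid_node s powi c i"
            if "r < W" for r i
          proof -
            have lr: "lo + r < hi" using that by (simp add: W_def)
            have "rarr \<psi> ''w'' 0 (int (hi + s * W + r)) =
                rarr \<phi> ''w'' 0 (int (lo + r)) * rarr \<phi> ''h'' 0 0 * rarr \<phi> ''q'' 0 (ivar \<phi> ''a'') \<and>
              (\<forall>i<m. rarr \<psi> ''d'' (int (hi + s * W + r)) (int i) =
                rarr \<phi> ''d'' (int (lo + r)) (int i) * rarr \<phi> ''q'' 0 (iarr \<phi> ''c'' (ivar \<phi> ''j'') (int i)))"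
              using 7(2) that unfolding W_def by blast
            then show "rarr \<psi> ''w'' 0 (int (hi + s * W + r)) =
              w (lo + r) * grid_weight m c K s * grid_node s ^ neg_part m c"
              "i < m \<Longrightarrow> rarr \<psi> ''d'' (int (hi + s * W + r)) (int i) = d (lo + r) i * grid_node s powi c i"
              by (simp_all only: w\<phi> d\<phi> h\<phi> q I(2)[OF lr] I(3)[OF lr])
          qed
          have before: "hi + s' * W + r < hi + s * W" if "s' < s" "r < W" for s' r
          proof -
            have "Suc s' * W \<le> s * W" using that(1) by (intro mult_le_mono1) simp
            then show ?thesis using that(2) by simp
          qed
          have block: "rarr \<psi> ''w'' 0 (int (hi + s' * W + r)) =
              w (lo + r) * grid_weight m c K s' * grid_node s' ^ neg_part m c \<and>
            (\<forall>i<m. rarr \<psi> ''d'' (int (hi + s' * W + r)) (int i) = d (lo + r) i * grid_node s' powi c i)"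
            if "s' < Suc s" "r < W" for s' r
          proof (cases "s' = s")
            case True
            then show ?thesis using new[OF that(2)] by simp
          next
            case False
            then have "s' < s" using that(1) by simp
            then show ?thesis
              using old[OF before[OF _ that(2)]] I(4,5)[OF _ that(2)] by simp
          qed
          have "t1 + (t2 + t3) \<le> T"
            using \<open>t1 \<le> _ \<and> _\<close> \<open>t2 \<le> _ \<and> _\<close> 7(2) unfolding T_def W_def by linarith
          moreover have "rarr \<psi> ''w'' 0 (int x) = w x \<and> (\<forall>i. rarr \<psi> ''d'' (int x) (int i) = d x i)"
            if "x < hi" for x
            using old[of x] I(2,3)[OF that] that by simp
          ultimately show ?case
            using e block by (simp del: of_nat_add of_nat_Suc)
        qed (use se\<phi> 5(1) 7(1) I(1) vars in \<open>simp_all add: same_except_def\<close>)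
      qed (use se\<upsilon> ab N in \<open>simp_all add: same_except_def\<close>)
    qed (use se ab K N 6(2,4) in \<open>simp_all add: same_except_def\<close>)
  next
    case (7 \<tau> t)
    let ?\<tau> = "\<tau>\<lparr>ivar := (ivar \<tau>)(''lo'' := int hi, ''hi'' := int (hi + (N + 1) * W))\<rparr>"
    have \<tau>: "ivar \<tau> ''m'' = int m" "ivar \<tau> ''hi'' = int hi" "rarr \<tau> ''L'' = rarr \<sigma> ''L''"
      using 7(1) vars by (simp_all add: same_except_def)
    have "grid_for m (\<lambda>S. P S \<and> (\<Sum>i\<in>S. c i) \<in> K) hi (hi + (l1_norm m c + 1) * (hi - lo))
        (\<lambda>r. rarr \<tau> ''w'' 0 (int r)) (\<lambda>r i. rarr \<tau> ''d'' (int r) (int i))"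
      by (rule grid_for_extend[OF grid \<open>lo \<le> hi\<close>])
        (use 7(2) in \<open>simp_all add: N_def[symmetric] W_def[symmetric] del: of_nat_add\<close>)
    then have "ready m X (\<lambda>S. P S \<and> (\<Sum>i\<in>S. c i) \<in> K) hi (hi + (l1_norm m c + 1) * (hi - lo)) ?\<tau>"
      using L by (simp add: ready_def \<tau> N_def W_def)
    moreover have "3 * 2 + (t + 2 + 2) \<le> 500 * (m + 1) * B^3"
    proof -
      have B1: "1 \<le> B" "N + 1 \<le> B" "W \<le> B" using B by (simp_all add: N_def W_def)
      have "(N + 1)^2 \<le> B^2" by (rule power_mono) (use B1 in auto)
      moreover have B2: "B \<le> B^2" "1 \<le> B^2" using B1 by (simp_all add: power2_eq_square)
      moreover have "(m + 1) * (W + 1) \<le> (m + 1) * (2 * B^2)"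
        by (rule mult_le_mono2) (use B1 B2 in linarith)
      then have "(m + 1) * (W + 1) \<le> 2 * ((m + 1) * B^2)" by (simp only: mult.left_commute)
      moreover have "B^2 \<le> (m + 1) * B^2" by simp
      moreover have "100 * x + 60 * y + 100 * z + 11 \<le> 400 * w"
        if "x \<le> b" "y \<le> B" "B \<le> b" "1 \<le> b" "z \<le> 2 * w" "b \<le> w" for x y z w b :: nat
        using that by linarith
      \<comment> \<open>The 11 consists of 5 for evaluating the loop bound and 6 for the remaining
        overhead of a pass.\<close>
      ultimately have "T + 11 \<le> 400 * ((m + 1) * B^2)"
        unfolding T_def mult.assoc using B1(2) by blast
      then have "(N + 1) * (T + 11) \<le> B * (400 * ((m + 1) * B^2))"
        using B1 by (intro mult_le_mono)
      moreover have "B * (400 * ((m + 1) * B^2)) = 400 * ((m + 1) * B^3)"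
        by (simp add: power2_eq_square power3_eq_cube algebra_simps)
      moreover have "1 * 1 \<le> (m + 1) * B^3" by (rule mult_le_mono) (use B1 in simp_all)
      moreover have "t \<le> 20 + (N + 1) * (T + 11)" using 7(3) by (simp add: algebra_simps)
      ultimately show ?thesis unfolding mult.assoc by linarith
    qed
    ultimately show ?case
      using 7(2) by (intro runs_Seq runs_ISet) (simp add: \<tau> del: of_nat_add)
  qed (use ab vars in \<open>simp_all add: same_except_def N w_def d_def\<close>)
qed

lemma runs_start_grid:
  assumes m: "ivar \<sigma> ''m'' = int m" and L: "\<And>i j. i < m \<Longrightarrow> j < m \<Longrightarrow> rarr \<sigma> ''L'' (int i) (int j) = X i j"
  shows "runs orc start_grid \<sigma> (\<lambda>\<tau> t. t \<le> 40 * (m + 1) \<and> ready m X (\<lambda>_. True) 0 1 \<tau>)"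
  unfolding start_grid_def
proof (rule runs_Seq, rule runs_ISet, rule runs_Seq, rule runs_ISet, rule runs_Seq, rule runs_RPut,
    rule runs_For[where l = 0 and h = m and T = 10 and
      I = "\<lambda>i \<tau>. \<forall>z<i. rarr \<tau> ''d'' 0 (int z) = 1"], goal_cases)
  case (6 i \<tau>)
  then show ?case by (intro runs_RPut) (auto simp: less_Suc_eq)
next
  case (7 \<tau> t)
  then show ?case using m L by (auto simp: ready_def grid_for_def same_except_def)
qed (use m in \<open>simp_all add: same_except_def\<close>)

text \<open>Each positive value at least doubles the product. Applied to the norms, it bounds the
  number of refinements by the final size of the grid.\<close>

lemma card_positive_le_prod:
  fixes f :: "nat \<Rightarrow> nat"
  shows "(\<Sum>j<p. of_bool (0 < f j)) \<le> (\<Prod>j<p. f j + 1)"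
proof (induction p)
  case (Suc p)
  have "1 \<le> (\<Prod>j<p. f j + 1)" by (simp add: Suc_le_eq prod_pos)
  then have "(\<Prod>j<p. f j + 1) + of_bool (0 < f p) \<le> (\<Prod>j<p. f j + 1) * (f p + 1)"
    by (cases "f p") simp_all
  with Suc show ?case by simp
qed simp

lemma prod_le_prod_nat:
  fixes f :: "nat \<Rightarrow> nat"
  assumes "j \<le> p"
  shows "(\<Prod>i<j. f i + 1) \<le> (\<Prod>i<p. f i + 1)"
  using assms
proof (induction p rule: dec_induct)
  case (step p)
  have "(\<Prod>i<p. f i + 1) * 1 \<le> (\<Prod>i<p. f i + 1) * (f p + 1)" by (rule mult_le_mono2) simp
  with step show ?case by simp
qed simp

text \<open>At most \<open>B\<close> refinements, each of time of order
  \<open>(m + 1) * B^3\<close>, give the term with \<open>B^4\<close>. The term with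
  \<open>p * (m + 1)\<close> is the scan of all cost vectors, zero ones included; it has no bound in
  terms of \<open>m\<close> and \<open>B\<close> and is later charged to reading the input.\<close>

lemma runs_build_grid:
  fixes c :: "nat \<Rightarrow> nat \<Rightarrow> int" and K :: "nat \<Rightarrow> int set" and m p :: nat
  defines "B \<equiv> \<Prod>j<p. l1_norm m (c j) + 1"
  assumes zero: "\<And>j. j < p \<Longrightarrow> l1_norm m (c j) = 0 \<Longrightarrow> 0 \<in> K j"
  shows "runs (membership p K) build_grid (init_state m L p c) (\<lambda>\<tau> t.
    t \<le> 500 * (m + 1) * B^4 + 70 * (p * (m + 1)) + 50 * (m + 1) \<and>
    (\<exists>lo hi. hi - lo = B \<and>
      ready m (\<lambda>i j. L $$ (i, j)) (\<lambda>S. \<forall>j<p. (\<Sum>i\<in>S. c j i) \<in> K j) lo hi \<tau>))"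
proof -
  let ?\<sigma> = "init_state m L p c"
  let ?X = "\<lambda>i j. L $$ (i, j)"
  let ?P = "\<lambda>n S. \<forall>j<n. (\<Sum>i\<in>S. c j i) \<in> K j"
  let ?N = "\<lambda>j. l1_norm m (c j)"
  let ?T = "\<lambda>j. of_bool (0 < ?N j) * (500 * (m + 1) * B^3) + 50 * (m + 1)"
  show ?thesis
    unfolding build_grid_def
  proof (rule runs_Seq, rule runs_weaken, rule runs_start_grid[where m = m and X = ?X], goal_cases)
    case (3 \<rho> t0)
    have \<rho>: "ivar \<rho> ''p'' = int p" "ivar \<rho> ''m'' = int m"
      "\<And>i j. j < p \<Longrightarrow> i < m \<Longrightarrow> iarr \<rho> ''c'' (int j) (int i) = c j i"
      using 3(1) by (simp_all add: same_except_def init_state_def)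
    show ?case
    proof (rule runs_For_sum[where l = 0 and h = p and T = ?T and
          I = "\<lambda>j \<tau>. \<exists>lo hi. hi - lo = (\<Prod>j<j. ?N j + 1) \<and> ready m ?X (?P j) lo hi \<tau>"], goal_cases)
      case 5
      show ?case using conjunct2[OF 3(2)] by (intro exI[of _ 0] exI[of _ 1]) (simp add: ready_def)
    next
      case (6 j \<tau>)
      obtain lo hi where I: "hi - lo = (\<Prod>j<j. ?N j + 1)" "ready m ?X (?P j) lo hi \<tau>"
        using 6(5) by blast
      have c: "i < m \<Longrightarrow> iarr \<tau> ''c'' (ivar \<tau> ''j'') (int i) = c j i" and m: "ivar \<tau> ''m'' = int m" for i
        using 6(2,3,4) \<rho> by (simp_all add: same_except_def)
      show ?case
      proof (rule runs_Seq, rule runs_weaken, rule runs_split_row[where m = m and c = "c j"], goal_cases)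
        case (3 \<upsilon> t1)
        have ready: "ready m ?X (?P j) lo hi \<upsilon>"
          using I(2) ready_same_except[OF 3(1)] by simp
        have ab: "ivar \<upsilon> ''a'' + ivar \<upsilon> ''b'' = int (?N j)"
          using 3(2) by (simp flip: neg_part_plus_pos_part)
        show ?case
        proof (rule runs_Cond, goal_cases)
          case 1
          then have pos: "0 < ?N j" using ab by simp
          have P: "?P (Suc j) S \<longleftrightarrow> ?P j S \<and> (\<Sum>i\<in>S. c j i) \<in> K j" for S
            by (auto simp: less_Suc_eq)
          have prod: "hi - lo \<le> B" "?N j + 1 \<le> B"
            "hi + (?N j + 1) * (hi - lo) - hi = (\<Prod>j<Suc j. ?N j + 1)"
          proof -
            show "hi - lo \<le> B" using I(1) prod_le_prod_nat[of j p ?N] 6(2) by (simp add: B_def)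
            show "hi + (?N j + 1) * (hi - lo) - hi = (\<Prod>j<Suc j. ?N j + 1)" using I(1) by simp
            have "1 \<le> (\<Prod>j<j. ?N j + 1)" by (simp add: Suc_le_eq prod_pos)
            then have "1 * (?N j + 1) \<le> (\<Prod>j<j. ?N j + 1) * (?N j + 1)" by (rule mult_le_mono1)
            then have "?N j + 1 \<le> (\<Prod>j<Suc j. ?N j + 1)" by simp
            also have "\<dots> \<le> B" using prod_le_prod_nat[of "Suc j" p ?N] 6(2) by (simp add: B_def)
            finally show "?N j + 1 \<le> B" .
          qed
          show ?case
          proof (rule runs_weaken, rule runs_refine_grid[OF ready, of "c j" _ "K j" B], goal_cases)
            case (7 \<phi> t2)
            have "ready m ?X (?P (Suc j)) hi (hi + (?N j + 1) * (hi - lo)) \<phi>"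
              unfolding P using 7(2) by blast
            then have "ready m ?X (?P (Suc j)) hi (hi + (?N j + 1) * (hi - lo))
                (\<phi>\<lparr>ivar := (ivar \<phi>)(''j'' := int (Suc j))\<rparr>)"
              by (simp add: ready_def)
            moreover have "t1 + (bcost (ILess (IConst 0) (IAdd (IVar ''a'') (IVar ''b''))) + t2) \<le> ?T j"
              using 7(2) 3(2) pos by simp
            ultimately show ?case using prod(3) by blast
          qed (use 3 6(2,4) c prod in \<open>simp_all add: same_except_def membership_def\<close>)
        next
          case 2
          then have z: "?N j = 0" using ab by simp
          have "?P j S \<longleftrightarrow> ?P (Suc j) S" if "S \<subseteq> {..<m}" for S
          proof -
            have "(\<Sum>i\<in>S. c j i) = 0"
              using z that by (intro sum.neutral) (auto simp: l1_norm_def)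
            then show ?thesis using zero[OF 6(2) z] by (auto simp: less_Suc_eq)
          qed
          then have "ready m ?X (?P (Suc j)) lo hi \<upsilon>"
            using ready ready_cong[of m "?P j" "?P (Suc j)"] by simp
          then have "ready m ?X (?P (Suc j)) lo hi (\<upsilon>\<lparr>ivar := (ivar \<upsilon>)(''j'' := int (Suc j))\<rparr>)"
            by (simp add: ready_def)
          moreover have "hi - lo = (\<Prod>j<Suc j. ?N j + 1)" using I(1) z by simp
          moreover have "t1 + (bcost (ILess (IConst 0) (IAdd (IVar ''a'') (IVar ''b''))) + 1) \<le> ?T j"
            using 3(2) z by simp
          ultimately show ?case by (intro runs_Skip) blast
        qed
      qed (use c m in simp_all)
    next
      case (7 \<tau> t)
      have "(\<Sum>j = 0..<p. of_bool (0 < ?N j) * x + y + icost (IVar ''p'') + 6) =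
          (\<Sum>j<p. of_bool (0 < ?N j)) * x + p * (y + 7)" for x y :: nat
        by (simp only: sum.distrib atLeast0LessThan sum_distrib_right[symmetric] sum_constant
            card_lessThan) (simp add: algebra_simps)
      then have "(\<Sum>j = 0..<p. ?T j + icost (IVar ''p'') + 6) =
          (\<Sum>j<p. of_bool (0 < ?N j)) * (500 * (m + 1) * B^3) + p * (50 * (m + 1) + 7)" .
      also have "\<dots> \<le> B * (500 * (m + 1) * B^3) + p * (50 * (m + 1) + 7)"
        unfolding B_def by (intro add_mono mult_le_mono1 card_positive_le_prod order_refl)
      also have "B * (500 * (m + 1) * B^3) = 500 * (m + 1) * B^4"
        by (simp add: power_numeral_reduce)
      finally have "(\<Sum>j = 0..<p. ?T j + icost (IVar ''p'') + 6) \<le> 500 * (m + 1) * B^4 + p * (50 * (m + 1) + 7)" .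
      moreover have "p * (50 * (m + 1) + 7) \<le> 70 * (p * (m + 1))" by (simp add: algebra_simps)
      moreover have "t0 \<le> 40 * (m + 1)" using 3(2) by simp
      moreover have "icost (IConst 0) + icost (IVar ''p'') + 3 = 5" by simp
      with 7(3) have "t \<le> 5 + (\<Sum>j = 0..<p. ?T j + icost (IVar ''p'') + 6)" by (simp only:)
      moreover have "t0 + t \<le> x + y + 50 * (m + 1)"
        if "s \<le> x + z" "z \<le> y" "t0 \<le> 40 * (m + 1)" "t \<le> 5 + s" for s x y z
      proof -
        have "t \<le> 5 + (x + y)" using that(1,2,4) by linarith
        with that(3) have "t0 + t \<le> 40 * (m + 1) + (5 + (x + y))" by (rule add_mono)
        then show ?thesis by simp
      qed
      ultimately have "t0 + t \<le> 500 * (m + 1) * B^4 + 70 * (p * (m + 1)) + 50 * (m + 1)" by blast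
      with 7(2) show ?case unfolding B_def by blast
    qed (use \<rho> in \<open>auto simp: same_except_def split_row_def\<close>)
  qed (simp_all add: init_state_def)
qed

section \<open>Sampling\<close>

text \<open>The time bound holds for every run in the support, not on average. Excluding
  \<open>None\<close> there rules out illegal tosses as well as unfinished runs.\<close>

definition samples ::
    "(int \<Rightarrow> int \<Rightarrow> bool) \<Rightarrow> nat \<Rightarrow> com \<Rightarrow> state \<Rightarrow> nat \<Rightarrow> (nat set \<Rightarrow> real) \<Rightarrow> bool" where
  "samples orc m c \<sigma> T \<phi> \<longleftrightarrow> (\<exists>N. \<forall>n\<ge>N.
     (\<forall>r\<in>set_pmf (exec orc n c \<sigma>). \<exists>\<tau> t. r = Some (\<tau>, t) \<and> t \<le> T) \<and>
     (\<forall>S. pmf (map_pmf (outcome m) (exec orc n c \<sigma>)) (Some S) = \<phi> S))"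

lemma map_outcome_tick: "map_pmf (outcome m) (tick s D) = map_pmf (outcome m) D"
  unfolding tick_def pmf.map_comp
  by (rule map_pmf_cong) (auto simp: outcome_def option.map_comp o_def case_prod_unfold)

lemma set_pmf_tick_bound:
  assumes "\<forall>r\<in>set_pmf D. \<exists>\<tau> t. r = Some (\<tau>, t) \<and> t \<le> T" "s + T \<le> T'"
  shows "\<forall>r\<in>set_pmf (tick s D). \<exists>\<tau> t. r = Some (\<tau>, t) \<and> t \<le> T'"
proof
  fix r assume "r \<in> set_pmf (tick s D)"
  then obtain r' where "r' \<in> set_pmf D" "r = map_option (\<lambda>(\<sigma>, t). (\<sigma>, s + t)) r'"
    by (auto simp: tick_def)
  with assms show "\<exists>\<tau> t. r = Some (\<tau>, t) \<and> t \<le> T'" by fastforce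
qed

lemma samples_runs:
  assumes "runs orc c \<sigma> (\<lambda>\<tau> t. t \<le> T \<and> output_set m \<tau> = A)"
  shows "samples orc m c \<sigma> T (\<lambda>S. of_bool (S = A))"
proof -
  obtain N \<tau> t where "\<And>n. n \<ge> N \<Longrightarrow> exec orc n c \<sigma> = return_pmf (Some (\<tau>, t))"
    and "t \<le> T" "output_set m \<tau> = A"
    using assms unfolding runs_def by blast
  then show ?thesis
    unfolding samples_def by (intro exI[of _ N]) (auto simp: outcome_def indicator_def)
qed

lemma samples_Seq_runs:
  assumes "runs orc c1 \<sigma> (\<lambda>\<rho> t. t \<le> T1 \<and> samples orc m c2 \<rho> T2 \<phi>)" "T1 + T2 \<le> T"
  shows "samples orc m (Seq c1 c2) \<sigma> T \<phi>"
proof -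
  obtain N1 \<rho> t where 1: "\<And>n. n \<ge> N1 \<Longrightarrow> exec orc n c1 \<sigma> = return_pmf (Some (\<rho>, t))"
    and t: "t \<le> T1" and "samples orc m c2 \<rho> T2 \<phi>"
    using assms(1) unfolding runs_def by blast
  then obtain N2 where 2: "\<And>n. n \<ge> N2 \<Longrightarrow>
      (\<forall>r\<in>set_pmf (exec orc n c2 \<rho>). \<exists>\<tau> t. r = Some (\<tau>, t) \<and> t \<le> T2) \<and>
      (\<forall>S. pmf (map_pmf (outcome m) (exec orc n c2 \<rho>)) (Some S) = \<phi> S)"
    unfolding samples_def by blast
  show ?thesis
    unfolding samples_def
  proof (intro exI[of _ "max N1 N2"] allI impI)
    fix n assume n: "n \<ge> max N1 N2"
    then have "exec orc n (Seq c1 c2) \<sigma> = tick t (exec orc n c2 \<rho>)"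
      by (simp add: 1 and_then_def bind_return_pmf)
    with 2[of n] n show "(\<forall>r\<in>set_pmf (exec orc n (Seq c1 c2) \<sigma>). \<exists>\<tau> t. r = Some (\<tau>, t) \<and> t \<le> T) \<and>
      (\<forall>S. pmf (map_pmf (outcome m) (exec orc n (Seq c1 c2) \<sigma>)) (Some S) = \<phi> S)"
      using set_pmf_tick_bound[of "exec orc n c2 \<rho>" T2 t T] t assms(2) by (simp add: map_outcome_tick)
  qed
qed

text \<open>Each branch has to be treated only if it has positive probability: an impossible branch
  would continue with zero conditional mass, and nothing can be sampled from that.\<close>

lemma samples_Seq_Toss:
  assumes q: "q = rval e \<sigma>" "0 \<le> q" "q \<le> 1"
    and True: "0 < q \<Longrightarrow> samples orc m c (\<sigma>\<lparr>ivar := (ivar \<sigma>)(x := 1)\<rparr>) T \<phi>1"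
    and False: "q < 1 \<Longrightarrow> samples orc m c (\<sigma>\<lparr>ivar := (ivar \<sigma>)(x := 0)\<rparr>) T \<phi>0"
  shows "samples orc m (Seq (Toss x e) c) \<sigma> (rcost e + 1 + T) (\<lambda>S. q * \<phi>1 S + (1 - q) * \<phi>0 S)"
proof -
  let ?\<sigma> = "\<lambda>h. \<sigma>\<lparr>ivar := (ivar \<sigma>)(x := (if h then 1 else 0))\<rparr>"
  let ?\<phi> = "\<lambda>h. if h then \<phi>1 else \<phi>0"
  have "\<exists>N. \<forall>n\<ge>N. h \<in> set_pmf (bernoulli_pmf q) \<longrightarrow>
      (\<forall>r\<in>set_pmf (exec orc n c (?\<sigma> h)). \<exists>\<tau> t. r = Some (\<tau>, t) \<and> t \<le> T) \<and>
      (\<forall>S. pmf (map_pmf (outcome m) (exec orc n c (?\<sigma> h))) (Some S) = ?\<phi> h S)" for h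
  proof (cases "h \<in> set_pmf (bernoulli_pmf q)")
    case True
    then have "pmf (bernoulli_pmf q) h > 0" by (simp add: pmf_positive_iff)
    then have "samples orc m c (?\<sigma> h) T (?\<phi> h)"
      using q assms(4,5) by (cases h) auto
    then show ?thesis unfolding samples_def by blast
  qed auto
  then obtain N where N: "\<And>h n. n \<ge> N h \<Longrightarrow> h \<in> set_pmf (bernoulli_pmf q) \<Longrightarrow>
      (\<forall>r\<in>set_pmf (exec orc n c (?\<sigma> h)). \<exists>\<tau> t. r = Some (\<tau>, t) \<and> t \<le> T) \<and>
      (\<forall>S. pmf (map_pmf (outcome m) (exec orc n c (?\<sigma> h))) (Some S) = ?\<phi> h S)"
    by metis
  show ?thesis
    unfolding samples_def
  proof (intro exI[of _ "max (N True) (N False)"] allI impI conjI)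
    fix n assume n: "n \<ge> max (N True) (N False)"
    have eq: "exec orc n (Seq (Toss x e) c) \<sigma> =
        bind_pmf (bernoulli_pmf q) (\<lambda>h. tick (rcost e + 1) (exec orc n c (?\<sigma> h)))"
      using q by (simp add: and_then_def bind_map_pmf)
    have N': "h \<in> set_pmf (bernoulli_pmf q) \<Longrightarrow>
      (\<forall>r\<in>set_pmf (exec orc n c (?\<sigma> h)). \<exists>\<tau> t. r = Some (\<tau>, t) \<and> t \<le> T) \<and>
      (\<forall>S. pmf (map_pmf (outcome m) (exec orc n c (?\<sigma> h))) (Some S) = ?\<phi> h S)" for h
      using N[of h n] n by (cases h) auto
    show "\<forall>r\<in>set_pmf (exec orc n (Seq (Toss x e) c) \<sigma>). \<exists>\<tau> t. r = Some (\<tau>, t) \<and> t \<le> rcost e + 1 + T"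
    proof
      fix r assume "r \<in> set_pmf (exec orc n (Seq (Toss x e) c) \<sigma>)"
      then obtain h where h: "h \<in> set_pmf (bernoulli_pmf q)"
        "r \<in> set_pmf (tick (rcost e + 1) (exec orc n c (?\<sigma> h)))"
        unfolding eq set_bind_pmf by blast
      show "\<exists>\<tau> t. r = Some (\<tau>, t) \<and> t \<le> rcost e + 1 + T"
        using set_pmf_tick_bound[OF conjunct1[OF N'[OF h(1)]] order_refl] h(2) by blast
    qed
    fix S
    \<comment> \<open>For an impossible outcome, about whose branch nothing is known, both sides are
      0.\<close>
    have h: "pmf (bernoulli_pmf q) h * pmf (map_pmf (outcome m) (exec orc n c (?\<sigma> h))) (Some S) =
        pmf (bernoulli_pmf q) h * ?\<phi> h S" for h
      using N'[of h] by (cases "h \<in> set_pmf (bernoulli_pmf q)") (simp_all add: set_pmf_iff)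
    have "pmf (map_pmf (outcome m) (exec orc n (Seq (Toss x e) c) \<sigma>)) (Some S) =
        q * pmf (map_pmf (outcome m) (exec orc n c (?\<sigma> True))) (Some S) +
        (1 - q) * pmf (map_pmf (outcome m) (exec orc n c (?\<sigma> False))) (Some S)"
      using q unfolding eq map_bind_pmf map_outcome_tick pmf_bind
      by (subst integral_bernoulli_pmf) (simp_all add: mult.commute)
    also have "\<dots> = q * \<phi>1 S + (1 - q) * \<phi>0 S"
      using h[of True] h[of False] q by auto
    finally show "pmf (map_pmf (outcome m) (exec orc n (Seq (Toss x e) c) \<sigma>)) (Some S) =
        q * \<phi>1 S + (1 - q) * \<phi>0 S" .
  qed
qed

section \<open>Reassociation and unrolling of sampling programs\<close>

lemma and_then_tick: "and_then (tick s D) g = tick s (and_then D g)"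
  unfolding and_then_def tick_def bind_map_pmf map_bind_pmf
  by (intro bind_pmf_cong refl)
    (auto simp: pmf.map_comp o_def option.map_comp case_prod_unfold add.assoc split: option.splits)

lemma and_then_assoc: "and_then (and_then D f) g = and_then D (\<lambda>\<sigma>. and_then (f \<sigma>) g)"
proof -
  have "and_then (and_then D f) g = bind_pmf D
      (\<lambda>r. and_then (case r of None \<Rightarrow> return_pmf None | Some (\<sigma>, t) \<Rightarrow> tick t (f \<sigma>)) g)"
    unfolding and_then_def[of D f] by (simp add: and_then_def[of _ g] bind_assoc_pmf)
  also have "\<dots> = and_then D (\<lambda>\<sigma>. and_then (f \<sigma>) g)"
    unfolding and_then_def[of D]
    by (intro bind_pmf_cong refl)
      (auto simp: and_then_tick split: option.splits simp: and_then_def[of "return_pmf _"] bind_return_pmf)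
  finally show ?thesis .
qed

text \<open>Unrolling the decision loop puts the toss inside the left part of a sequence.
  Reassociation makes everything after the toss, including the rest of the loop, its
  continuation.\<close>

lemma exec_Seq_assoc: "exec orc n (Seq (Seq c1 c2) c3) = exec orc n (Seq c1 (Seq c2 c3))"
proof -
  have "exec orc n (Seq c2 c3) = (\<lambda>\<sigma>. and_then (exec orc n c2 \<sigma>) (exec orc n c3))" by auto
  then show ?thesis by (auto simp: and_then_assoc)
qed

lemma samples_Seq_assoc:
  "samples orc m (Seq c1 (Seq c2 c3)) \<sigma> T \<phi> \<Longrightarrow> samples orc m (Seq (Seq c1 c2) c3) \<sigma> T \<phi>"
  by (simp only: samples_def exec_Seq_assoc)

lemma samples_While_True:
  assumes "bval orc b \<sigma>" "samples orc m (Seq c (While b c)) \<sigma> T \<phi>" "bcost b + T \<le> T'"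
  shows "samples orc m (While b c) \<sigma> T' \<phi>"
proof -
  obtain N where N: "\<And>n. n \<ge> N \<Longrightarrow>
      (\<forall>r\<in>set_pmf (exec orc n (Seq c (While b c)) \<sigma>). \<exists>\<tau> t. r = Some (\<tau>, t) \<and> t \<le> T) \<and>
      (\<forall>S. pmf (map_pmf (outcome m) (exec orc n (Seq c (While b c)) \<sigma>)) (Some S) = \<phi> S)"
    using assms(2) unfolding samples_def by blast
  show ?thesis
    unfolding samples_def
  proof (intro exI[of _ "Suc N"] allI impI)
    fix n assume "n \<ge> Suc N"
    then obtain n' where n': "n = Suc n'" "n' \<ge> N" by (cases n) auto
    then have "exec orc n (While b c) \<sigma> = tick (bcost b) (exec orc n' (Seq c (While b c)) \<sigma>)"
      using assms(1) by simp
    with N[OF n'(2)] assms(3)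
    show "(\<forall>r\<in>set_pmf (exec orc n (While b c) \<sigma>). \<exists>\<tau> t. r = Some (\<tau>, t) \<and> t \<le> T') \<and>
      (\<forall>S. pmf (map_pmf (outcome m) (exec orc n (While b c) \<sigma>)) (Some S) = \<phi> S)"
      using set_pmf_tick_bound[of "exec orc n' (Seq c (While b c)) \<sigma>" T "bcost b" T']
      by (simp only: map_outcome_tick) simp
  qed
qed

text \<open>The element \<open>n\<close> is marked as chosen before it is decided, so that the
  evaluation gives the mass of the completions that contain it. The toss then decides whether the
  mark stays.\<close>

definition tentative :: com where
  "tentative = Seq (IPut ''S'' (IConst 0) (IVar ''n'') (IConst 1)) evaluate"

text \<open>\<open>Y\<close> is the mass of all sets compatible with the decisions so far. After a
  rejection it is found by subtraction, so each element needs only one evaluation.\<close>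

definition update :: com where
  "update = Seq (IPut ''S'' (IConst 0) (IVar ''n'') (IVar ''x''))
    (Seq (IPut ''E'' (IConst 0) (IVar ''n'') (ISub (IConst 1) (IVar ''x'')))
    (Seq (Cond (ILess (IConst 0) (IVar ''x'')) (RSet ''Y'' (RVar ''Z''))
        (RSet ''Y'' (RSub (RVar ''Y'') (RVar ''Z''))))
      (ISet ''n'' (IAdd (IVar ''n'') (IConst 1)))))"

definition decide_all :: com where
  "decide_all = While (ILess (IVar ''n'') (IVar ''m''))
    (Seq tentative (Seq (Toss ''x'' (RDiv (RVar ''Z'') (RVar ''Y''))) update))"

definition draw_set :: com where
  "draw_set = Seq (Seq evaluate (Seq (RSet ''Y'' (RVar ''Z'')) (ISet ''n'' (IConst 0)))) decide_all"

definition decided :: "nat \<Rightarrow> nat set \<Rightarrow> nat set \<Rightarrow> state \<Rightarrow> bool" where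
  "decided m A B \<sigma> \<longleftrightarrow> (\<forall>i<m. iarr \<sigma> ''S'' 0 (int i) = of_bool (i \<in> A)) \<and>
     (\<forall>i<m. iarr \<sigma> ''E'' 0 (int i) = of_bool (i \<in> B))"

lemma decided_same_except:
  assumes "same_except V \<sigma> \<tau>" "V \<inter> {''S'', ''E''} = {}"
  shows "decided m A B \<tau> = decided m A B \<sigma>"
  using assms unfolding decided_def same_except_def by simp

lemma runs_evaluate_ready:
  assumes X: "psd_on {..<m} X" and \<sigma>: "ready m X P lo hi \<sigma>" "decided m A B \<sigma>" and A: "A \<subseteq> {..<m}"
  shows "runs orc evaluate \<sigma> (\<lambda>\<tau> t. t \<le> 300 * (m + 1)^3 * (hi - lo + 1) \<and>
    rvar \<tau> ''Z'' = (\<Sum>T | T \<subseteq> {..<m} \<and> A \<subseteq> T \<and> T \<inter> B = {}. of_bool (P T) * pdet T X))"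
proof -
  let ?w = "\<lambda>r. rarr \<sigma> ''w'' 0 (int r)" and ?d = "\<lambda>r i. rarr \<sigma> ''d'' (int r) (int i)"
  have grid: "grid_for m P lo hi ?w ?d" using \<sigma> by (simp add: ready_def)
  show ?thesis
    unfolding sum_grid_pdet_masked[OF grid A, symmetric]
  proof (rule runs_evaluate)
    fix r assume r: "lo \<le> r" "r < hi"
    show "psd_on {..<m} (masked X A B (?d r))"
      by (rule psd_on_masked) (use X grid r in \<open>auto simp: grid_for_def intro: less_imp_le\<close>)
    fix i j assume "i < m" "j < m"
    then show "masked X A B (?d r) i j = masked_entry \<sigma> (int i) (int j) +
        (if i = j then ?d r i * of_int (1 - iarr \<sigma> ''S'' 0 (int i)) else 0)"
      using \<sigma> by (auto simp: masked_def masked_entry_def ready_def decided_def)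
  qed (use \<sigma> in \<open>auto simp: ready_def\<close>)
qed

section \<open>Masses of cylinders and the chain rule\<close>

definition cylinder_sum :: "nat \<Rightarrow> (nat set \<Rightarrow> real) \<Rightarrow> nat \<Rightarrow> nat set \<Rightarrow> real" where
  "cylinder_sum m g n A = (\<Sum>T | T \<subseteq> {..<m} \<and> T \<inter> {..<n} = A. g T)"

lemma cylinder_sum_split:
  assumes "n < m" "A \<subseteq> {..<n}"
  shows "cylinder_sum m g n A = cylinder_sum m g (Suc n) (insert n A) + cylinder_sum m g (Suc n) A"
proof -
  have "{T. T \<subseteq> {..<m} \<and> T \<inter> {..<n} = A} =
    {T. T \<subseteq> {..<m} \<and> T \<inter> {..<Suc n} = insert n A} \<union> {T. T \<subseteq> {..<m} \<and> T \<inter> {..<Suc n} = A}"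
    using assms by (auto simp: lessThan_Suc)
  moreover have "{T. T \<subseteq> {..<m} \<and> T \<inter> {..<Suc n} = insert n A} \<inter>
      {T. T \<subseteq> {..<m} \<and> T \<inter> {..<Suc n} = A} = {}"
    using assms by auto
  ultimately show ?thesis
    unfolding cylinder_sum_def by (simp add: sum.union_disjoint)
qed

lemma cylinder_sum_nonneg:
  "(\<And>T. T \<subseteq> {..<m} \<Longrightarrow> 0 \<le> g T) \<Longrightarrow> 0 \<le> cylinder_sum m g n A"
  unfolding cylinder_sum_def by (rule sum_nonneg) auto

lemma le_cylinder_sum:
  assumes "\<And>T. T \<subseteq> {..<m} \<Longrightarrow> 0 \<le> g T" "S \<subseteq> {..<m}" "S \<inter> {..<n} = A"
  shows "g S \<le> cylinder_sum m g n A"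
  unfolding cylinder_sum_def by (rule member_le_sum) (use assms in auto)

lemma cylinder_sum_full:
  assumes "A \<subseteq> {..<m}"
  shows "cylinder_sum m g m A = g A"
proof -
  have "{T. T \<subseteq> {..<m} \<and> T \<inter> {..<m} = A} = {A}" using assms by auto
  then show ?thesis by (simp add: cylinder_sum_def)
qed

text \<open>The chain rule as a backward induction: from a state with decided part \<open>A\<close>,
  the remaining loop samples the distribution conditioned on the cylinder of \<open>A\<close>.
  Positive mass of the cylinder is inherited, because only outcomes of positive probability are
  followed.\<close>

lemma samples_decide_all:
  fixes X :: "nat \<Rightarrow> nat \<Rightarrow> real" and P :: "nat set \<Rightarrow> bool"
  defines "g \<equiv> \<lambda>T. of_bool (P T) * pdet T X"
  assumes X: "psd_on {..<m} X" and n: "n \<le> m" and A: "A \<subseteq> {..<n}"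
    and \<sigma>: "ready m X P lo hi \<sigma>" "decided m A ({..<n} - A) \<sigma>" "ivar \<sigma> ''n'' = int n"
      "rvar \<sigma> ''Y'' = cylinder_sum m g n A"
    and pos: "0 < cylinder_sum m g n A"
  shows "samples orc m decide_all \<sigma> ((m - n) * (300 * (m + 1)^3 * (hi - lo + 1) + 60) + 3)
    (\<lambda>S. if S \<subseteq> {..<m} \<and> S \<inter> {..<n} = A then g S / cylinder_sum m g n A else 0)"
  using n A \<sigma> pos
proof (induction n arbitrary: A \<sigma> rule: inc_induct)
  case base
  have "runs orc decide_all \<sigma> (\<lambda>\<tau> t. t \<le> (m - m) * (300 * (m + 1)^3 * (hi - lo + 1) + 60) + 3 \<and>
      output_set m \<tau> = A)"
    unfolding decide_all_def
    by (rule runs_While_False)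
      (use base in \<open>auto simp: ready_def decided_def output_set_def\<close>)
  then have "samples orc m decide_all \<sigma> ((m - m) * (300 * (m + 1)^3 * (hi - lo + 1) + 60) + 3)
      (\<lambda>S. of_bool (S = A))"
    by (rule samples_runs)
  moreover have "(\<lambda>S. of_bool (S = A)) =
      (\<lambda>S. if S \<subseteq> {..<m} \<and> S \<inter> {..<m} = A then g S / cylinder_sum m g m A else 0)"
    using base(1,6) by (auto simp: fun_eq_iff cylinder_sum_full)
  ultimately show ?case by simp
next
  case (step n)
  let ?V = "300 * (m + 1)^3 * (hi - lo + 1)"
  let ?G = "cylinder_sum m g"
  define T where "T = (m - Suc n) * (?V + 60) + 3"
  define \<phi> where "\<phi> n A = (\<lambda>S. if S \<subseteq> {..<m} \<and> S \<inter> {..<n} = A then g S / ?G n A else 0)" for n A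
  define q where "q = ?G (Suc n) (insert n A) / ?G n A"
  have nm: "n < m" by fact
  have g: "0 \<le> g T" if "T \<subseteq> {..<m}" for T
    unfolding g_def
    using pdet_nonneg[OF finite_subset[OF that finite_lessThan] psd_on_subset[OF X that finite_lessThan]]
    by simp
  have split: "?G n A = ?G (Suc n) (insert n A) + ?G (Suc n) A"
    by (rule cylinder_sum_split) (use step in auto)
  have nn: "0 \<le> ?G k B" for k B by (rule cylinder_sum_nonneg) (rule g)
  have q: "0 \<le> q" "q \<le> 1"
    using split nn[of "Suc n"] step.prems(6) by (simp_all add: q_def)
  have q1: "1 - q = ?G (Suc n) A / ?G n A"
    using split step.prems(6) by (simp add: q_def field_simps)
  \<comment> \<open>The marks present after the tentative choice describe exactly the cylinder of
    the accepting outcome.\<close>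
  have sets: "{T. T \<subseteq> {..<m} \<and> insert n A \<subseteq> T \<and> T \<inter> ({..<n} - A) = {}} =
      {T. T \<subseteq> {..<m} \<and> T \<inter> {..<Suc n} = insert n A}"
    using step.prems(1) by (auto simp: lessThan_Suc)

  have continue: "samples orc m (Seq update decide_all) \<rho> (40 + T) (\<phi> (Suc n) A')"
    if \<rho>: "same_except {''S'', ''Z'', ''r'', ''D'', ''k'', ''i'', ''j'', ''M'', ''x''} \<sigma> \<rho>"
      "decided m (insert n A) ({..<n} - A) \<rho>" "rvar \<rho> ''Z'' = ?G (Suc n) (insert n A)"
      "ivar \<rho> ''x'' = of_bool h" and A': "A' = (if h then insert n A else A)"
      and pos': "0 < ?G (Suc n) A'" for \<rho> h A'
  proof (rule samples_Seq_runs)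
    have \<rho>': "ivar \<rho> ''n'' = int n" "rvar \<rho> ''Y'' = ?G n A"
      using \<rho>(1) step.prems(4,5) by (simp_all add: same_except_def)
    have update: "runs orc update \<rho> (\<lambda>\<tau> t. t \<le> 40 \<and> decided m A' ({..<Suc n} - A') \<tau> \<and>
        ivar \<tau> ''n'' = int (Suc n) \<and> rvar \<tau> ''Y'' = ?G (Suc n) A')"
      unfolding update_def
      by (intro runs_Seq runs_IPut runs_Cond runs_RSet runs_ISet)
        (use \<rho> \<rho>' A' step.prems(1) nm split in
          \<open>auto simp: decided_def lessThan_Suc split: if_splits\<close>)
    show "runs orc update \<rho> (\<lambda>\<tau> t. t \<le> 40 \<and> samples orc m decide_all \<tau> T (\<phi> (Suc n) A'))"
    proof (rule runs_weaken[OF update], intro conjI)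
      fix \<tau> t
      assume se: "same_except (written update) \<rho> \<tau>"
        and post: "t \<le> 40 \<and> decided m A' ({..<Suc n} - A') \<tau> \<and>
          ivar \<tau> ''n'' = int (Suc n) \<and> rvar \<tau> ''Y'' = ?G (Suc n) A'"
      show "t \<le> 40" using post by simp
      have "ready m X P lo hi \<tau> = ready m X P lo hi \<sigma>"
        by (subst ready_same_except[OF se], simp add: update_def)
          (rule ready_same_except[OF \<rho>(1)], simp)
      then show "samples orc m decide_all \<tau> T (\<phi> (Suc n) A')"
        unfolding T_def \<phi>_def
        using post step.prems(1,2) A' pos'
        by (intro step.IH) (auto simp: lessThan_Suc)
    qed
  qed simp

  have "samples orc m
      (Seq (Seq tentative (Seq (Toss ''x'' (RDiv (RVar ''Z'') (RVar ''Y''))) update)) decide_all)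
      \<sigma> (?V + 5 + (4 + (40 + T))) (\<phi> n A)"
  proof (rule samples_Seq_assoc, rule samples_Seq_runs[OF _ order_refl])
    let ?\<sigma> = "\<sigma>\<lparr>iarr := (iarr \<sigma>)(''S'' := (iarr \<sigma> ''S'')(0 := (iarr \<sigma> ''S'' 0)(int n := 1)))\<rparr>"
    have se\<sigma>: "same_except {''S''} \<sigma> ?\<sigma>" by (simp add: same_except_def)
    have r\<sigma>: "ready m X P lo hi ?\<sigma>" using ready_same_except[OF se\<sigma>] step.prems(2) by simp
    have d\<sigma>: "decided m (insert n A) ({..<n} - A) ?\<sigma>"
      using step.prems(3) by (auto simp: decided_def)
    have ev: "runs orc evaluate ?\<sigma> (\<lambda>\<tau> t. t \<le> ?V \<and> rvar \<tau> ''Z'' = ?G (Suc n) (insert n A))"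
      unfolding cylinder_sum_def g_def sets[symmetric]
      by (rule runs_evaluate_ready[OF X r\<sigma> d\<sigma>]) (use step.prems(1) nm in auto)
    have "runs orc tentative \<sigma> (\<lambda>\<tau> t. t \<le> ?V + 5 \<and> rvar \<tau> ''Z'' = ?G (Suc n) (insert n A) \<and>
        decided m (insert n A) ({..<n} - A) \<tau>)"
      unfolding tentative_def
    proof (rule runs_Seq, rule runs_IPut, simp only: ival.simps step.prems(4), rule runs_weaken[OF ev])
      fix \<tau> t
      assume "same_except (written evaluate) ?\<sigma> \<tau>" "t \<le> ?V \<and> rvar \<tau> ''Z'' = ?G (Suc n) (insert n A)"
      then show "icost (IConst 0) + icost (IVar ''n'') + icost (IConst 1) + 1 + t \<le> ?V + 5 \<and>
          rvar \<tau> ''Z'' = ?G (Suc n) (insert n A) \<and> decided m (insert n A) ({..<n} - A) \<tau>"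
        using decided_same_except[of "written evaluate" ?\<sigma> \<tau>] d\<sigma> by simp
    qed
    then show "runs orc tentative \<sigma> (\<lambda>\<tau> t. t \<le> ?V + 5 \<and>
      samples orc m (Seq (Seq (Toss ''x'' (RDiv (RVar ''Z'') (RVar ''Y''))) update) decide_all) \<tau>
        (4 + (40 + T)) (\<phi> n A))"
    proof (rule runs_weaken, intro conjI)
      fix \<tau> t
      assume se: "same_except (written tentative) \<sigma> \<tau>"
        and post: "t \<le> ?V + 5 \<and> rvar \<tau> ''Z'' = ?G (Suc n) (insert n A) \<and>
          decided m (insert n A) ({..<n} - A) \<tau>"
      show "t \<le> ?V + 5" using post by simp
      have se': "same_except {''S'', ''Z'', ''r'', ''D'', ''k'', ''i'', ''j'', ''M'', ''x''} \<sigma>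
          (\<tau>\<lparr>ivar := (ivar \<tau>)(''x'' := v)\<rparr>)" for v
        using se by (auto simp: same_except_def tentative_def)
      have dec: "decided m (insert n A) ({..<n} - A) (\<tau>\<lparr>ivar := (ivar \<tau>)(''x'' := v)\<rparr>)" for v
        using post by (simp add: decided_def)
      have "q = rval (RDiv (RVar ''Z'') (RVar ''Y'')) \<tau>"
        using post se step.prems(5) by (simp add: q_def same_except_def tentative_def)
      then have "samples orc m (Seq (Toss ''x'' (RDiv (RVar ''Z'') (RVar ''Y''))) (Seq update decide_all)) \<tau>
        (rcost (RDiv (RVar ''Z'') (RVar ''Y'')) + 1 + (40 + T))
        (\<lambda>S. q * \<phi> (Suc n) (insert n A) S + (1 - q) * \<phi> (Suc n) A S)"
      proof (rule samples_Seq_Toss[OF _ q])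
        assume "0 < q"
        then have "0 < ?G (Suc n) (insert n A)"
          using nn[of "Suc n" "insert n A"] by (cases "?G (Suc n) (insert n A) = 0") (auto simp: q_def)
        then show "samples orc m (Seq update decide_all) (\<tau>\<lparr>ivar := (ivar \<tau>)(''x'' := 1)\<rparr>) (40 + T)
            (\<phi> (Suc n) (insert n A))"
          using post by (intro continue[where h = True] se' dec) auto
      next
        assume "q < 1"
        then have "0 < ?G (Suc n) A"
          using nn[of "Suc n" A] q1 by (cases "?G (Suc n) A = 0") auto
        then show "samples orc m (Seq update decide_all) (\<tau>\<lparr>ivar := (ivar \<tau>)(''x'' := 0)\<rparr>) (40 + T)
            (\<phi> (Suc n) A)"
          using post by (intro continue[where h = False] se' dec) auto
      qed
      moreover have "q * \<phi> (Suc n) (insert n A) S + (1 - q) * \<phi> (Suc n) A S = \<phi> n A S" for S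
      proof -
        \<comment> \<open>A branch of mass zero contributes 0 to the mixture; this is the right
          value, since nonnegativity forces every set in its cylinder to have weight 0.\<close>
        have zero: "g S = 0" if "S \<subseteq> {..<m}" "S \<inter> {..<Suc n} = B" "?G (Suc n) B = 0" for B
          using le_cylinder_sum[of m g S "Suc n" B] g that by (simp add: antisym)
        have iff: "S \<inter> {..<n} = A \<longleftrightarrow> S \<inter> {..<Suc n} = insert n A \<or> S \<inter> {..<Suc n} = A"
          and ne: "insert n A \<noteq> A"
          using step.prems(1) by (auto simp: lessThan_Suc)
        consider "\<not> S \<subseteq> {..<m}" | "S \<subseteq> {..<m}" "S \<inter> {..<Suc n} = insert n A"
          | "S \<subseteq> {..<m}" "S \<inter> {..<Suc n} = A"
          | "S \<inter> {..<Suc n} \<noteq> insert n A" "S \<inter> {..<Suc n} \<noteq> A" by blast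
        then show ?thesis
        proof cases
          case 1
          then show ?thesis by (simp add: \<phi>_def)
        next
          case 2
          then show ?thesis
            using ne zero[OF 2] by (cases "?G (Suc n) (insert n A) = 0") (simp_all add: \<phi>_def iff q_def)
        next
          case 3
          then show ?thesis
            using ne zero[OF 3] by (cases "?G (Suc n) A = 0") (simp_all add: \<phi>_def iff q1)
        next
          case 4
          then show ?thesis by (simp add: \<phi>_def iff)
        qed
      qed
      ultimately show "samples orc m
          (Seq (Seq (Toss ''x'' (RDiv (RVar ''Z'') (RVar ''Y''))) update) decide_all) \<tau>
        (4 + (40 + T)) (\<phi> n A)"
        by (intro samples_Seq_assoc) simp
    qed
  qed
  then have "samples orc m decide_all \<sigma> ((m - n) * (?V + 60) + 3) (\<phi> n A)"
    unfolding decide_all_def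
  proof (rule samples_While_True[rotated])
    show "bval orc (ILess (IVar ''n'') (IVar ''m'')) \<sigma>"
      using step.prems(2,4) nm by (simp add: ready_def)
    have "m - n = Suc (m - Suc n)" using nm by simp
    then show "bcost (ILess (IVar ''n'') (IVar ''m'')) + (?V + 5 + (4 + (40 + T))) \<le> (m - n) * (?V + 60) + 3"
      by (simp add: T_def)
  qed
  then show ?case by (simp only: \<phi>_def)
qed

lemma samples_draw_set:
  fixes X :: "nat \<Rightarrow> nat \<Rightarrow> real" and P :: "nat set \<Rightarrow> bool"
  defines "g \<equiv> \<lambda>T. of_bool (P T) * pdet T X"
  assumes X: "psd_on {..<m} X" and \<sigma>: "ready m X P lo hi \<sigma>" "decided m {} {} \<sigma>"
    and pos: "0 < sum g (Pow {..<m})"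
  shows "samples orc m draw_set \<sigma> ((m + 1) * (300 * (m + 1)^3 * (hi - lo + 1) + 60))
    (\<lambda>S. if S \<subseteq> {..<m} then g S / sum g (Pow {..<m}) else 0)"
proof -
  let ?V = "300 * (m + 1)^3 * (hi - lo + 1)"
  have Pow: "cylinder_sum m g 0 {} = sum g (Pow {..<m})"
    by (simp add: cylinder_sum_def Pow_def)
  have "runs orc (Seq evaluate (Seq (RSet ''Y'' (RVar ''Z'')) (ISet ''n'' (IConst 0)))) \<sigma>
    (\<lambda>\<rho> t. t \<le> ?V + 10 \<and> samples orc m decide_all \<rho> (m * (?V + 60) + 3)
      (\<lambda>S. if S \<subseteq> {..<m} then g S / sum g (Pow {..<m}) else 0))"
  proof (rule runs_Seq, rule runs_weaken[OF runs_evaluate_ready[OF X \<sigma>]])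
    fix \<tau> t
    assume se: "same_except (written evaluate) \<sigma> \<tau>" and post: "t \<le> ?V \<and>
      rvar \<tau> ''Z'' = (\<Sum>T | T \<subseteq> {..<m} \<and> {} \<subseteq> T \<and> T \<inter> {} = {}. of_bool (P T) * pdet T X)"
    let ?\<rho> = "\<tau>\<lparr>rvar := (rvar \<tau>)(''Y'' := rvar \<tau> ''Z''), ivar := (ivar \<tau>)(''n'' := 0)\<rparr>"
    have se': "same_except (insert ''Y'' (insert ''n'' (written evaluate))) \<sigma> ?\<rho>"
      using se by (auto simp: same_except_def)
    have "samples orc m decide_all ?\<rho> ((m - 0) * (?V + 60) + 3)
      (\<lambda>S. if S \<subseteq> {..<m} \<and> S \<inter> {..<0} = {} then of_bool (P S) * pdet S X /
        cylinder_sum m (\<lambda>T. of_bool (P T) * pdet T X) 0 {} else 0)"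
      by (rule samples_decide_all[OF X])
        (use ready_same_except[OF se'] decided_same_except[OF se'] \<sigma> post pos Pow
          in \<open>auto simp: g_def cylinder_sum_def\<close>)
    then have "samples orc m decide_all ?\<rho> (m * (?V + 60) + 3)
      (\<lambda>S. if S \<subseteq> {..<m} then g S / sum g (Pow {..<m}) else 0)"
      unfolding g_def Pow[unfolded g_def, symmetric] by simp
    with post show "runs orc (Seq (RSet ''Y'' (RVar ''Z'')) (ISet ''n'' (IConst 0))) \<tau> (\<lambda>\<rho> t2.
        t + t2 \<le> ?V + 10 \<and> samples orc m decide_all \<rho> (m * (?V + 60) + 3)
          (\<lambda>S. if S \<subseteq> {..<m} then g S / sum g (Pow {..<m}) else 0))"
      by (intro runs_Seq runs_RSet runs_ISet) simp
  qed simp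
  then show ?thesis
    unfolding draw_set_def by (rule samples_Seq_runs) simp
qed

theorem corollary1p2:
  shows "\<exists>(prog :: com) (Q :: nat poly poly) (C :: nat).
    \<forall>(m :: nat) (L :: real mat) (p :: nat) (c :: nat \<Rightarrow> nat \<Rightarrow> int) (K :: nat \<Rightarrow> int set).
      psd_mat m L \<longrightarrow>
      (\<Sum>T\<in>linear_family m p c K. principal_minor L T) > 0 \<longrightarrow>
      (\<exists>n. let D = exec (membership p K) n prog (init_state m L p c) in
        (\<forall>r\<in>set_pmf D. \<exists>\<sigma> t. r = Some (\<sigma>, t) \<and>
            t \<le> poly2 Q m (\<Prod>j<p. (l1_norm m (c j) + 1)) + C * input_size m p) \<and>
        (\<forall>S. pmf (map_pmf (outcome m) D) (Some S) =
            (if S \<in> linear_family m p c K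
             then principal_minor L S / (\<Sum>T\<in>linear_family m p c K. principal_minor L T)
             else 0)))"
proof (intro exI[of _ "Seq build_grid draw_set"] allI impI,
    rule exI[of _ "[:[:1000:]:] * [:[:1, 1:]:] ^ 4 * [:1, 1:] ^ 4"], rule exI[of _ 70], intro allI impI)
  fix m p :: nat and L :: "real mat" and c :: "nat \<Rightarrow> nat \<Rightarrow> int" and K :: "nat \<Rightarrow> int set"
  let ?F = "linear_family m p c K" and ?X = "\<lambda>i j. L $$ (i, j)"
  let ?P = "\<lambda>S. \<forall>j<p. (\<Sum>i\<in>S. c j i) \<in> K j"
  \<comment> \<open>This is \<open>1000 * (m + 1)^4 * (B + 1)^4\<close>, with the inner variable for
    \<open>m\<close> and the outer one for \<open>B\<close>. The constant covers 500 from the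
    refinements, 300 from the evaluations and 110 from the terms linear in \<open>m + 1\<close>; the
    factor 70 for the input size comes from the scan of the cost vectors.\<close>
  let ?Q = "[:[:1000:]:] * [:[:1, 1:]:] ^ 4 * [:1, 1:] ^ 4 :: nat poly poly"
  define B where "B = (\<Prod>j<p. l1_norm m (c j) + 1)"
  define g where "g T = of_bool (?P T) * pdet T ?X" for T
  assume L: "psd_mat m L" and pos: "(\<Sum>T\<in>?F. principal_minor L T) > 0"
  have car: "L \<in> carrier_mat m m" using L by (simp add: psd_mat_def)
  have X: "psd_on {..<m} ?X" using L by (rule psd_mat_imp_psd_on)
  have F: "?F = {S \<in> Pow {..<m}. ?P S}" by (auto simp: linear_family_def)
  have "sum g (Pow {..<m}) = sum g ?F"
    by (rule sum.mono_neutral_right) (auto simp: F g_def)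
  also have "\<dots> = (\<Sum>T\<in>?F. principal_minor L T)"
    by (rule sum.cong) (auto simp: F g_def principal_minor_eq_pdet[OF car])
  finally have sum_g: "sum g (Pow {..<m}) = (\<Sum>T\<in>?F. principal_minor L T)" .
  have zero: "0 \<in> K j" if "j < p" "l1_norm m (c j) = 0" for j
  proof -
    have "?F \<noteq> {}" using pos by (intro notI) simp
    then obtain S where "S \<in> ?F" by blast
    then have "S \<subseteq> {..<m}" "(\<Sum>i\<in>S. c j i) \<in> K j" using that(1) by (auto simp: F)
    moreover have "(\<Sum>i\<in>S. c j i) = 0"
      using that(2) \<open>S \<subseteq> {..<m}\<close> by (intro sum.neutral) (auto simp: l1_norm_def)
    ultimately show ?thesis by simp
  qed
  let ?Tb = "500 * (m + 1) * B^4 + 70 * (p * (m + 1)) + 50 * (m + 1)"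
  let ?Td = "(m + 1) * (300 * (m + 1)^3 * (B + 1) + 60)"
  let ?\<phi> = "\<lambda>S. if S \<subseteq> {..<m} then g S / sum g (Pow {..<m}) else 0"
  have "samples (membership p K) m (Seq build_grid draw_set) (init_state m L p c) (?Tb + ?Td) ?\<phi>"
  proof (rule samples_Seq_runs, rule runs_weaken, rule runs_build_grid[of p m c K L], rule zero)
    fix \<tau> t
    assume se: "same_except (written build_grid) (init_state m L p c) \<tau>"
      and post: "t \<le> 500 * (m + 1) * (\<Prod>j<p. l1_norm m (c j) + 1)^4 + 70 * (p * (m + 1)) + 50 * (m + 1) \<and>
        (\<exists>lo hi. hi - lo = (\<Prod>j<p. l1_norm m (c j) + 1) \<and> ready m ?X ?P lo hi \<tau>)"
    then obtain lo hi where "hi - lo = B" "ready m ?X ?P lo hi \<tau>" by (auto simp: B_def)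
    moreover have "decided m {} {} (init_state m L p c)" by (simp add: decided_def init_state_def)
    then have "decided m {} {} \<tau>"
      by (subst decided_same_except[OF se]) (simp_all add: build_grid_def)
    ultimately have "samples (membership p K) m draw_set \<tau> ?Td ?\<phi>"
      using samples_draw_set[OF X, of ?P lo hi \<tau> "membership p K"] pos sum_g
      unfolding g_def[abs_def] by simp
    then show "t \<le> ?Tb \<and> samples (membership p K) m draw_set \<tau> ?Td ?\<phi>"
      using post by (simp add: B_def)
  qed simp_all
  then obtain n where n:
    "\<forall>r\<in>set_pmf (exec (membership p K) n (Seq build_grid draw_set) (init_state m L p c)).
      \<exists>\<tau> t. r = Some (\<tau>, t) \<and> t \<le> ?Tb + ?Td"
    "\<And>S. pmf (map_pmf (outcome m) (exec (membership p K) n (Seq build_grid draw_set) (init_state m L p c)))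
      (Some S) = ?\<phi> S"
    unfolding samples_def by blast
  have "?Tb + ?Td \<le> poly2 ?Q m B + 70 * input_size m p"
  proof -
    let ?M = "(m + 1)^4" and ?Y = "(B + 1)^4"
    have "(m + 1) * (300 * x * (B + 1) + 60) = 300 * ((m + 1) * x * (B + 1)) + 60 * (m + 1)" for x
      by (simp add: algebra_simps)
    moreover have "?M = (m + 1) * (m + 1)^3" by (simp add: power_numeral_reduce)
    ultimately have Td: "?Td = 300 * (?M * (B + 1)) + 60 * (m + 1)" by metis
    have "poly2 ?Q m B = 1000 * (?M * ?Y)" by (simp add: poly2_def poly_power add.commute)
    moreover have "p * (m + 1) \<le> input_size m p" by (simp add: input_size_def)
    moreover have m: "m + 1 \<le> ?M" and Y: "B + 1 \<le> ?Y" "1 \<le> ?Y" "B^4 \<le> ?Y"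
      using self_le_power[of "m + 1" 4] self_le_power[of "B + 1" 4] power_mono[of B "B + 1" 4]
      by simp_all
    moreover have "(m + 1) * B^4 \<le> ?M * ?Y" by (rule mult_le_mono[OF m Y(3)])
    moreover have "?M * (B + 1) \<le> ?M * ?Y" by (rule mult_le_mono2[OF Y(1)])
    moreover have "(m + 1) * 1 \<le> ?M * ?Y" by (rule mult_le_mono[OF m Y(2)])
    moreover have "500 * (m + 1) * B^4 = 500 * ((m + 1) * B^4)" by (simp only: mult.assoc)
    ultimately show ?thesis unfolding Td by linarith
  qed
  with n(1) have "\<forall>r\<in>set_pmf (exec (membership p K) n (Seq build_grid draw_set) (init_state m L p c)).
      \<exists>\<tau> t. r = Some (\<tau>, t) \<and> t \<le> poly2 ?Q m B + 70 * input_size m p"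
    by (meson order_trans)
  moreover have "?\<phi> S = (if S \<in> ?F then principal_minor L S / (\<Sum>T\<in>?F. principal_minor L T) else 0)" for S
    using sum_g by (auto simp: F g_def principal_minor_eq_pdet[OF car])
  ultimately show "\<exists>n. let D = exec (membership p K) n (Seq build_grid draw_set) (init_state m L p c) in
        (\<forall>r\<in>set_pmf D. \<exists>\<sigma> t. r = Some (\<sigma>, t) \<and>
            t \<le> poly2 ?Q m (\<Prod>j<p. (l1_norm m (c j) + 1)) + 70 * input_size m p) \<and>
        (\<forall>S. pmf (map_pmf (outcome m) D) (Some S) =
            (if S \<in> ?F then principal_minor L S / (\<Sum>T\<in>?F. principal_minor L T) else 0))"
    unfolding Let_def B_def using n(2) by (intro exI[of _ n]) simp
qed

end
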